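(* Let $\mu=N_d(A)$ and $\nu=N_d(B)$ be two centered Gaussian measures on $\mathbb{R}^d$ with full-rank covariance matrices $A$ and $B$, let $\Sigma\in S_{2d}^{++}(\mathbb{R})$ and $\varepsilon>0$. Then the regularized optimal transport problem $$W_\Sigma^\varepsilon(\mu,\nu):=\inf_{\pi\in\Pi(\mu,\nu)}\int_{\mathbb{R}^d\times\mathbb{R}^d}\|x-y\|^2\,d\pi(x,y)+2\varepsilon\,\mathrm{KL}(\pi\,|\,N_{2d}(\Sigma))$$ reduces to the minimization problem $$W_\Sigma^{\varepsilon}(\mu,\nu)=\min_{C\in\Pi^{+}(A,B)}\left\{\left\langle Y+\varepsilon\Sigma^{-1},X_C\right\rangle_{\mathrm{HS}}-\varepsilon\log\det(X_C)\right\}+\varepsilon\log\det(\Sigma)-2\varepsilon d,$$ where $$Y:=\begin{pmatrix}I_d&-I_d\\-I_d&I_d\end{pmatrix},\qquad X_C:=\begin{pmatrix}A&C\\C^T&B\end{pmatrix},\qquad \Pi^+(A,B):=\{C\in M_d(\mathbb{R})\;|\;X_C\geq 0\}.$$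
   Context: $M_d(\mathbb{R})$ is the space of real $d\times d$ matrices, $S_{k}^{++}(\mathbb{R})$ the set of real symmetric positive-definite $k\times k$ matrices, and $X\ge 0$ means $X$ is symmetric positive-semidefinite; $\langle P,Q\rangle_{\mathrm{HS}}:=\mathrm{tr}(PQ^T)$. $N_d(A)$ denotes the centered Gaussian measure on $\mathbb{R}^d$ with covariance $A$, and $N_{2d}(\Sigma)$ the centered Gaussian measure on $\mathbb{R}^d\times\mathbb{R}^d$ with covariance $\Sigma$. $\Pi(\mu,\nu)$ is the set of probability measures on $\mathbb{R}^d\times\mathbb{R}^d$ with first marginal $\mu$ and second marginal $\nu$. $\mathrm{KL}(\pi|\pi_{\mathrm{ref}}):=\int\log\left(\frac{d\pi}{d\pi_{\mathrm{ref}}}\right)d\pi$ if $\pi$ is absolutely continuous with respect to $\pi_{\mathrm{ref}}$, and $+\infty$ otherwise. By convention $-\log\det(X_C)=+\infty$ when $\det(X_C)=0$. *)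

theory Defs
  imports "HOL-Probability.Probability"
begin

section \<open>Matrices\<close>

definition psd :: "real^'n^'n \<Rightarrow> bool" where
  "psd A \<longleftrightarrow> transpose A = A \<and> (\<forall>x. 0 \<le> x \<bullet> (A *v x))"

definition pos_def :: "real^'n^'n \<Rightarrow> bool" where
  "pos_def A \<longleftrightarrow> transpose A = A \<and> (\<forall>x. x \<noteq> 0 \<longrightarrow> 0 < x \<bullet> (A *v x))"

definition hs_inner :: "real^'n^'m \<Rightarrow> real^'n^'m \<Rightarrow> real" where
  "hs_inner P Q = trace (P ** transpose Q)"

text \<open>Matrices of size \<open>2d\<close> are indexed by the sum type \<open>'d + 'd\<close>, with \<open>Inl\<close> for the first
  and \<open>Inr\<close> for the second block.\<close>

definition block_matrix ::
  "real^'d^'d \<Rightarrow> real^'d^'d \<Rightarrow> real^'d^'d \<Rightarrow> real^'d^'d \<Rightarrow> real^('d::finite + 'd)^('d + 'd)" where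
  "block_matrix P Q R S = (\<chi> i j.
     case i of
       Inl a \<Rightarrow> (case j of Inl b \<Rightarrow> P $ a $ b | Inr b \<Rightarrow> Q $ a $ b)
     | Inr a \<Rightarrow> (case j of Inl b \<Rightarrow> R $ a $ b | Inr b \<Rightarrow> S $ a $ b))"

definition Y_mat :: "real^('d::finite + 'd)^('d + 'd)" where
  "Y_mat = block_matrix (mat 1) (- mat 1) (- mat 1) (mat 1)"

definition X_mat :: "real^'d^'d \<Rightarrow> real^'d^'d \<Rightarrow> real^'d^'d \<Rightarrow> real^('d::finite + 'd)^('d + 'd)" where
  "X_mat A B C = block_matrix A C (transpose C) B"

definition Pi_plus :: "real^'d::finite^'d \<Rightarrow> real^'d^'d \<Rightarrow> (real^'d^'d) set" where
  "Pi_plus A B = {C. psd (X_mat A B C)}"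

definition neg_log_det :: "real^'n^'n \<Rightarrow> ereal" where
  "neg_log_det X = (if det X = 0 then \<infinity> else ereal (- ln (det X)))"

section \<open>Gaussian measures\<close>

text \<open>The centered Gaussian measure with covariance matrix \<open>A\<close>, for positive definite \<open>A\<close> only:
  a singular \<open>A\<close> does not give the degenerate Gaussian.\<close>

definition gaussian :: "real^'n^'n \<Rightarrow> (real^'n) measure" where
  "gaussian A = density lborel (\<lambda>x. ennreal
     (exp (- (x \<bullet> (matrix_inv A *v x)) / 2) / sqrt ((2 * pi) ^ CARD('n) * det A)))"

definition split_vec :: "real^('d::finite + 'd) \<Rightarrow> (real^'d) \<times> (real^'d)" where
  "split_vec z = ((\<chi> i. z $ Inl i), (\<chi> i. z $ Inr i))"

definition gaussian_pair :: "real^('d::finite + 'd)^('d + 'd) \<Rightarrow> ((real^'d) \<times> (real^'d)) measure" where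
  "gaussian_pair \<Sigma> = distr (gaussian \<Sigma>) borel split_vec"

section \<open>Regularized optimal transport\<close>

definition couplings :: "'a measure \<Rightarrow> 'b measure \<Rightarrow> ('a \<times> 'b) measure set" where
  "couplings \<mu> \<nu> = {\<pi>. prob_space \<pi> \<and> sets \<pi> = sets (\<mu> \<Otimes>\<^sub>M \<nu>) \<and>
     distr \<pi> \<mu> fst = \<mu> \<and> distr \<pi> \<nu> snd = \<nu>}"

text \<open>\<open>integral\<^sup>L\<close>, and with it \<open>KL_divergence\<close>, is \<open>0\<close> on non-integrable functions. A
  divergence of \<open>\<infinity>\<close> therefore needs the integral of a real function as an extended real, the
  difference of the integrals of its positive and negative part.\<close>

definition ext_integral :: "'a measure \<Rightarrow> ('a \<Rightarrow> real) \<Rightarrow> ereal" where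
  "ext_integral M f =
     enn2ereal (\<integral>\<^sup>+x. ennreal (f x) \<partial>M) - enn2ereal (\<integral>\<^sup>+x. ennreal (- f x) \<partial>M)"

text \<open>\<open>entropy_density (exp 1) R P\<close> is the natural logarithm of \<open>dP/dR\<close>. Its negative part is
  \<open>P\<close>-integrable for probability measures \<open>P\<close> and \<open>R\<close>, so \<open>\<infinity> - \<infinity>\<close> does not occur.\<close>

definition KL :: "'a measure \<Rightarrow> 'a measure \<Rightarrow> ereal" where
  "KL P R = (if absolutely_continuous R P then ext_integral P (entropy_density (exp 1) R P) else \<infinity>)"

definition W_reg :: "real^('d::finite + 'd)^('d + 'd) \<Rightarrow> real \<Rightarrow>
    (real^'d) measure \<Rightarrow> (real^'d) measure \<Rightarrow> ereal" where
  "W_reg \<Sigma> \<epsilon> \<mu> \<nu> = (INF \<pi> \<in> couplings \<mu> \<nu>.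
     enn2ereal (\<integral>\<^sup>+z. ennreal ((norm (fst z - snd z))\<^sup>2) \<partial>\<pi>) +
     ereal (2 * \<epsilon>) * KL \<pi> (gaussian_pair \<Sigma>))"

definition matrix_objective :: "real^('d::finite + 'd)^('d + 'd) \<Rightarrow> real \<Rightarrow>
    real^'d^'d \<Rightarrow> real^'d^'d \<Rightarrow> real^'d^'d \<Rightarrow> ereal" where
  "matrix_objective \<Sigma> \<epsilon> A B C =
     ereal (hs_inner (Y_mat + \<epsilon> *\<^sub>R matrix_inv \<Sigma>) (X_mat A B C)) +
     ereal \<epsilon> * neg_log_det (X_mat A B C)"

end

theory Submission
  imports Defs
begin

text \<open>
The transport cost is a quadratic function of \<open>z = (x, y)\<close>, so for a coupling \<open>\<pi>\<close> its integral depends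
on the second moments of \<open>\<pi>\<close> only. The marginals fix the diagonal blocks of the second moment matrix,
which therefore has the form \<open>X_mat A B C\<close> with \<open>C \<in> Pi_plus A B\<close> (\<open>coupling_second_moments\<close>).

The divergence is not determined by the second moments, but it is smallest for the Gaussian that has
them. The log-density of \<open>gaussian_pair X\<close> with respect to \<open>gaussian_pair \<Sigma>\<close> is a quadratic
polynomial \<open>q\<close>. The Donsker-Varadhan inequality \<open>KL_ge_integral\<close> bounds the divergence of any coupling
from below by its integral of \<open>q\<close>, which depends on \<open>X\<close> only, and the Gaussian attains this bound
(\<open>KL_density_exp\<close>). Evaluating the integral gives the matrix objective up to the stated constant. If
the second moment matrix is singular, the coupling lives on a hyperplane and both sides are infinite
(\<open>KL_singular\<close>).

Up to this constant, every coupling therefore costs at least the matrix objective at its own \<open>C\<close>. Conversely, if \<open>X_mat A B C\<close>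
is positive definite, \<open>gaussian_pair (X_mat A B C)\<close> is a coupling (\<open>gaussian_pair_in_couplings\<close>) whose
cost equals the matrix objective at \<open>C\<close>. The matrix objective has a minimiser with this property
(\<open>matrix_objective_attains_min\<close>), so the infimum over couplings is the minimum over matrices.

Normalisation, second moments and marginals of a Gaussian are derived from the standard Gaussian by
writing the covariance matrix as \<open>M ** transpose M\<close>. The Gram-Schmidt construction of \<open>M\<close> also makes it
block triangular with respect to a prescribed set of coordinates, and this yields the marginals.
\<close>

section \<open>Positive definite matrices\<close>

lemma symmetric_inner_commute:
  assumes "transpose A = (A::real^'n^'n)"
  shows "x \<bullet> (A *v y) = y \<bullet> (A *v x)"
  by (metis assms dot_lmul_matrix inner_commute vector_transpose_matrix)

lemma pos_def_det_nz:
  assumes "pos_def (A::real^'n^'n)"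
  shows "det A \<noteq> 0"
proof -
  have "A *v x \<noteq> A *v y" if "x \<noteq> y" for x y
  proof
    assume "A *v x = A *v y"
    then have "A *v (x - y) = 0" by (simp add: matrix_vector_mult_diff_distrib)
    then show False using assms that unfolding pos_def_def
      by (metis inner_zero_right less_irrefl right_minus_eq)
  qed
  then have "inj ((*v) A)" by (auto simp: inj_def)
  then show ?thesis by (metis det_nz_iff_inj matrix_of_matrix_vector_mul matrix_vector_mul_linear)
qed

text \<open>If \<open>x \<bullet> (A *v x) = 0\<close>, the form is nonnegative and vanishes at \<open>x\<close>, so it is stationary there:
expanding it along \<open>x - t *\<^sub>R y\<close> with \<open>y = A *v x\<close> leaves \<open>t\<^sup>2 c - 2 t (y \<bullet> y)\<close>, which is negative
for small positive \<open>t\<close> unless \<open>y = 0\<close>, that is, unless \<open>x = 0\<close> by invertibility.\<close>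

lemma psd_det_nz_imp_pos_def:
  assumes "psd (A::real^'n^'n)" "det A \<noteq> 0"
  shows "pos_def A"
  unfolding pos_def_def
proof (intro conjI allI impI)
  show sym: "transpose A = A" using assms(1) by (simp add: psd_def)
  have nonneg: "0 \<le> x \<bullet> (A *v x)" for x using assms(1) by (simp add: psd_def)
  fix x :: "real^'n" assume "x \<noteq> 0"
  show "0 < x \<bullet> (A *v x)"
  proof (rule ccontr)
    assume "\<not> 0 < x \<bullet> (A *v x)"
    then have 0: "x \<bullet> (A *v x) = 0" using nonneg[of x] by simp
    have "inj ((*v) A)" using assms(2) by (metis det_nz_iff_inj matrix_of_matrix_vector_mul matrix_vector_mul_linear)
    define y where "y = A *v x"
    have "y \<noteq> 0" using \<open>inj ((*v) A)\<close> \<open>x \<noteq> 0\<close> unfolding y_def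
      by (metis injD matrix_vector_mult_0_right)
    define c where "c = y \<bullet> (A *v y)"
    have q: "0 \<le> t\<^sup>2 * c - 2 * t * (y \<bullet> y)" for t
    proof -
      have xy: "x \<bullet> (A *v y) = y \<bullet> y" by (metis symmetric_inner_commute[OF sym] y_def)
      have yx: "y \<bullet> (A *v x) = y \<bullet> y" by (simp add: y_def)
      have "(x - t *\<^sub>R y) \<bullet> (A *v (x - t *\<^sub>R y)) = t\<^sup>2 * c - 2 * t * (y \<bullet> y)"
        using 0 xy yx by (simp add: matrix_vector_mult_diff_distrib matrix_vector_mult_scaleR
            inner_diff_left inner_diff_right c_def power2_eq_square algebra_simps)
      then show ?thesis using nonneg[of "x - t *\<^sub>R y"] by simp
    qed
    have yy: "0 < y \<bullet> y" using \<open>y \<noteq> 0\<close> by simp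
    have "0 \<le> c" using nonneg c_def by simp
    \<comment> \<open>The shift by 1 keeps the denominator positive when \<open>c = 0\<close>.\<close>
    define t where "t = (y \<bullet> y) / (c + 1)"
    have "t > 0" "t * c \<le> y \<bullet> y" using yy \<open>0 \<le> c\<close>
      by (auto simp: t_def field_simps)
    then have "t * (t * c - 2 * (y \<bullet> y)) < 0" using yy by (intro mult_pos_neg) linarith+
    then show False using q[of t] by (simp add: power2_eq_square algebra_simps)
  qed
qed

text \<open>Gram-Schmidt for the inner product defined by \<open>W\<close>, applied to the coordinate vectors. Keeping track
of the supports has two benefits. The residual of \<open>axis k 1\<close> has \<open>k\<close>-th entry 1 because the
previous vectors vanish there, so it is nonzero without any argument about linear independence; and
the order in which indices are processed turns into a triangular shape of the resulting matrix.\<close>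

lemma gram_schmidt_step:
  fixes W :: "real^'n^'n" and u :: "'n \<Rightarrow> real^'n"
  assumes W: "pos_def W" and "k \<notin> I"
    and on: "\<And>i j. i \<in> I \<Longrightarrow> j \<in> I \<Longrightarrow> u i \<bullet> (W *v u j) = (if i = j then 1 else 0)"
    and supp: "\<And>i l. i \<in> I \<Longrightarrow> l \<notin> I \<Longrightarrow> u i $ l = 0"
  obtains w where "w \<bullet> (W *v w) = 1" "\<And>i. i \<in> I \<Longrightarrow> u i \<bullet> (W *v w) = 0"
    "\<And>l. l \<notin> insert k I \<Longrightarrow> w $ l = 0"
proof -
  define r where "r = axis k 1 - (\<Sum>j\<in>I. (u j \<bullet> (W *v axis k 1)) *\<^sub>R u j)"
  have "r $ k = 1" using \<open>k \<notin> I\<close> by (simp add: r_def supp)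
  then have "r \<noteq> 0" by auto
  then have pos: "0 < r \<bullet> (W *v r)" using W by (simp add: pos_def_def)
  have orth: "u i \<bullet> (W *v r) = 0" if "i \<in> I" for i
  proof -
    have "u i \<bullet> (W *v r) = u i \<bullet> (W *v axis k 1)
        - (\<Sum>j\<in>I. (u j \<bullet> (W *v axis k 1)) * (u i \<bullet> (W *v u j)))"
      by (simp add: r_def matrix_vector_mult_diff_distrib inner_diff_right inner_sum_right
          linear_sum[OF matrix_vector_mul_linear] matrix_vector_mult_scaleR)
    also have "(\<Sum>j\<in>I. (u j \<bullet> (W *v axis k 1)) * (u i \<bullet> (W *v u j)))
        = (\<Sum>j\<in>I. if j = i then u j \<bullet> (W *v axis k 1) else 0)"
      using that by (intro sum.cong) (auto simp: on)
    also have "\<dots> = u i \<bullet> (W *v axis k 1)" using that by simp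
    finally show ?thesis by simp
  qed
  show thesis
  proof
    let ?s = "sqrt (r \<bullet> (W *v r))"
    show "(r /\<^sub>R ?s) \<bullet> (W *v (r /\<^sub>R ?s)) = 1"
      using pos by (simp add: matrix_vector_mult_scaleR divide_simps)
    show "u i \<bullet> (W *v (r /\<^sub>R ?s)) = 0" if "i \<in> I" for i
      using orth[OF that] by (simp add: matrix_vector_mult_scaleR)
    show "(r /\<^sub>R ?s) $ l = 0" if "l \<notin> insert k I" for l
      using that supp by (auto simp: r_def axis_def)
  qed
qed

lemma gram_schmidt_extend:
  fixes W :: "real^'n^'n"
  assumes W: "pos_def W" and "I \<inter> J = {}"
    and on: "\<And>i j. i \<in> I \<Longrightarrow> j \<in> I \<Longrightarrow> u i \<bullet> (W *v u j) = (if i = j then 1 else 0)"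
    and supp: "\<And>i l. i \<in> I \<Longrightarrow> l \<notin> I \<Longrightarrow> u i $ l = 0"
  shows "\<exists>v. (\<forall>i\<in>I. v i = u i) \<and>
    (\<forall>i\<in>I\<union>J. \<forall>j\<in>I\<union>J. v i \<bullet> (W *v v j) = (if i = j then 1 else 0)) \<and>
    (\<forall>i\<in>I\<union>J. \<forall>l. l \<notin> I\<union>J \<longrightarrow> v i $ l = 0)"
  using finite[of J] \<open>I \<inter> J = {}\<close>
proof (induction J rule: finite_induct)
  case empty
  show ?case using on supp by (intro exI[of _ u]) auto
next
  case (insert k J)
  then obtain v where v: "\<forall>i\<in>I. v i = u i"
    "\<And>i j. i \<in> I\<union>J \<Longrightarrow> j \<in> I\<union>J \<Longrightarrow> v i \<bullet> (W *v v j) = (if i = j then 1 else 0)"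
    "\<And>i l. i \<in> I\<union>J \<Longrightarrow> l \<notin> I\<union>J \<Longrightarrow> v i $ l = 0"
    by auto
  have k: "k \<notin> I \<union> J" using insert by auto
  obtain w where w: "w \<bullet> (W *v w) = 1" "\<And>i. i \<in> I\<union>J \<Longrightarrow> v i \<bullet> (W *v w) = 0"
    "\<And>l. l \<notin> insert k (I\<union>J) \<Longrightarrow> w $ l = 0"
    using gram_schmidt_step[of W k "I \<union> J" v, OF W k v(2,3)] by metis
  have w': "w \<bullet> (W *v v i) = 0" if "i \<in> I\<union>J" for i
    using w(2)[OF that] symmetric_inner_commute W unfolding pos_def_def by metis
  show ?case
    using k v w w' by (intro exI[of _ "v(k := w)"]) (auto split: if_splits)
qed

text \<open>The columns of \<open>M\<close> are the vectors obtained by processing first the indices outside \<open>S\<close> and then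
those in \<open>S\<close>. Columns of the first kind are supported outside \<open>S\<close>, hence the vanishing block.\<close>

lemma block_triangular_factor:
  fixes W :: "real^'n^'n"
  assumes W: "pos_def W"
  shows "\<exists>M :: real^'n^'n. transpose M ** W ** M = mat 1 \<and>
    (\<forall>i\<in>S. \<forall>k. k \<notin> S \<longrightarrow> M $ i $ k = 0)"
proof -
  obtain v where v: "\<forall>i\<in>-S. \<forall>j\<in>-S. v i \<bullet> (W *v v j) = (if i = j then 1 else 0)"
     "\<forall>i\<in>-S. \<forall>l. l \<notin> -S \<longrightarrow> v i $ l = 0"
    using gram_schmidt_extend[OF W, of "{}" "-S"] by auto
  obtain u where u: "\<forall>i\<in>-S. u i = v i"
     "\<And>i j. u i \<bullet> (W *v u j) = (if i = j then 1 else 0)"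
    using gram_schmidt_extend[OF W, of "-S" S v] v by auto
  define M where "M = (\<chi> i k. u k $ i)"
  have col: "column k M = u k" for k by (simp add: M_def column_def vec_eq_iff)
  have "(transpose M ** W ** M) $ i $ j = u i \<bullet> (W *v u j)" for i j
  proof -
    have "(transpose M ** W ** M) $ i $ j = (\<Sum>k\<in>UNIV. (\<Sum>l\<in>UNIV. u i $ l * W $ l $ k) * u j $ k)"
      by (simp add: matrix_matrix_mult_def transpose_def M_def)
    also have "\<dots> = u i \<bullet> (W *v u j)"
      unfolding inner_vec_def matrix_vector_mult_def
      by (simp add: sum_distrib_left sum_distrib_right mult.assoc) (rule sum.swap)
    finally show ?thesis .
  qed
  then have "transpose M ** W ** M = mat 1" by (simp add: vec_eq_iff mat_def u)
  moreover have "M $ i $ k = 0" if "i \<in> S" "k \<notin> S" for i k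
    using that u(1) v(2) by (simp add: M_def)
  ultimately show ?thesis by blast
qed

lemma pos_def_det_pos:
  assumes W: "pos_def (W::real^'n^'n)"
  shows "0 < det W"
proof -
  obtain M :: "real^'n^'n" where "transpose M ** W ** M = mat 1"
    using block_triangular_factor[OF W, of UNIV] by blast
  then have "det (transpose M ** W ** M) = 1" by simp
  then have "det M * det W * det M = 1" by (simp add: det_mul)
  then have "det W * (det M)\<^sup>2 = 1" by (metis mult.assoc mult.commute power2_eq_square)
  then show ?thesis
    using mult_nonpos_nonneg[of "det W" "(det M)\<^sup>2"] by fastforce
qed

lemma matrix_inv_mult:
  assumes "det (A::real^'n^'n) \<noteq> 0"
  shows "A ** matrix_inv A = mat 1" "matrix_inv A ** A = mat 1"
proof -
  have "\<exists>A'. A ** A' = mat 1 \<and> A' ** A = mat 1"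
    using assms by (simp add: invertible_det_nz[symmetric] invertible_def)
  from someI_ex[OF this] show "A ** matrix_inv A = mat 1" "matrix_inv A ** A = mat 1"
    unfolding matrix_inv_def by auto
qed

lemma matrix_inv_unique_right:
  assumes "A ** B = mat 1"
  shows "matrix_inv (A::real^'n^'n) = B"
proof -
  have "det A * det B = 1" using assms by (metis det_I det_mul)
  then have "det A \<noteq> 0" by auto
  then show ?thesis using matrix_inv_mult[of A] assms
    by (metis matrix_mul_assoc matrix_mul_lid matrix_mul_rid)
qed

lemma pos_def_matrix_inv:
  assumes A: "pos_def (A::real^'n^'n)"
  shows "pos_def (matrix_inv A)"
  unfolding pos_def_def
proof (intro conjI allI impI)
  let ?B = "matrix_inv A"
  have inv: "A ** ?B = mat 1" "?B ** A = mat 1"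
    using matrix_inv_mult[OF pos_def_det_nz[OF A]] by auto
  have sym: "transpose A = A" using A by (simp add: pos_def_def)
  have "A ** transpose ?B = mat 1"
    by (metis inv(2) matrix_transpose_mul sym transpose_mat)
  then show sB: "transpose ?B = ?B" by (metis matrix_inv_unique_right)
  fix x :: "real^'n" assume "x \<noteq> 0"
  define y where "y = ?B *v x"
  have x: "x = A *v y" by (simp add: y_def matrix_vector_mul_assoc inv)
  then have "y \<noteq> 0" using \<open>x \<noteq> 0\<close> by auto
  then have "0 < y \<bullet> (A *v y)" using A by (simp add: pos_def_def)
  then show "0 < x \<bullet> (?B *v x)" by (simp add: x[symmetric] y_def[symmetric] inner_commute)
qed

text \<open>A factor of \<open>X\<close> comes from \<open>W = matrix_inv X\<close> above. For \<open>z = M *v w\<close> the vanishing block says that the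
coordinates \<open>z $ i\<close> with \<open>i \<in> S\<close> depend on the coordinates \<open>w $ k\<close> with \<open>k \<in> S\<close> only, which is what
makes the marginals of a Gaussian accessible.\<close>

lemma pos_def_factor:
  fixes X :: "real^'n^'n"
  assumes X: "pos_def X"
  shows "\<exists>M :: real^'n^'n. X = M ** transpose M \<and> det M \<noteq> 0 \<and>
    (\<forall>i\<in>S. \<forall>k. k \<notin> S \<longrightarrow> M $ i $ k = 0)"
proof -
  obtain M :: "real^'n^'n" where M: "transpose M ** matrix_inv X ** M = mat 1"
    "\<forall>i\<in>S. \<forall>k. k \<notin> S \<longrightarrow> M $ i $ k = 0"
    using block_triangular_factor[OF pos_def_matrix_inv[OF X], where S = S] by blast
  have "det (transpose M) * det (matrix_inv X) * det M = 1" using M(1) by (metis det_I det_mul)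
  then have d: "det M \<noteq> 0" by auto
  have inv: "X ** matrix_inv X = mat 1" "matrix_inv X ** X = mat 1"
    using matrix_inv_mult[OF pos_def_det_nz[OF X]] by auto
  have "M ** (transpose M ** matrix_inv X) = mat 1"
    using M(1) matrix_left_right_inverse by metis
  then have "M ** transpose M = X" using inv
    by (metis matrix_mul_assoc matrix_mul_lid matrix_mul_rid)
  then show ?thesis using d M(2) by metis
qed

section \<open>Linear change of variables for Lebesgue measure\<close>

lemma prod_Basis_cart:
  fixes f :: "real^'n \<Rightarrow> 'a::comm_monoid_mult"
  shows "(\<Prod>b\<in>Basis. f b) = (\<Prod>i\<in>UNIV. f (axis i 1))"
proof -
  have "Basis = range (\<lambda>i::'n. axis i (1::real))" by (auto simp: Basis_vec_def)
  moreover have "inj (\<lambda>i::'n. axis i (1::real))" by (auto simp: inj_def axis_eq_axis)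
  ultimately show ?thesis by (metis (no_types, lifting) o_apply prod.cong prod.reindex)
qed

lemma sum_Basis_cart:
  fixes f :: "real^'n \<Rightarrow> 'a::comm_monoid_add"
  shows "(\<Sum>b\<in>Basis. f b) = (\<Sum>i\<in>UNIV. f (axis i 1))"
proof -
  have "Basis = range (\<lambda>i::'n. axis i (1::real))" by (auto simp: Basis_vec_def)
  moreover have "inj (\<lambda>i::'n. axis i (1::real))" by (auto simp: inj_def axis_eq_axis)
  ultimately show ?thesis by (metis (no_types, lifting) o_apply sum.cong sum.reindex)
qed

text \<open>The change of variables formula for one matrix. Singular matrices satisfy it vacuously, so that the
predicate is closed under products and elementary matrices generate all instances.\<close>

definition scales_lborel :: "real^'n^'n \<Rightarrow> bool" where
  "scales_lborel A \<longleftrightarrow> (det A \<noteq> 0 \<longrightarrow>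
    density (distr lborel borel ((*v) A)) (\<lambda>_. ennreal \<bar>det A\<bar>) = lborel)"

lemma measurable_matrix_vector_mult [measurable]:
  "(*v) (A::real^'n^'m) \<in> borel \<rightarrow>\<^sub>M borel"
  by (intro borel_measurable_continuous_onI linear_continuous_on) auto

lemma scales_lborel_mult:
  fixes A B :: "real^'n^'n"
  assumes "scales_lborel A" "scales_lborel B"
  shows "scales_lborel (A ** B)"
  unfolding scales_lborel_def
proof
  assume "det (A ** B) \<noteq> 0"
  then have nz: "det A \<noteq> 0" "det B \<noteq> 0" by (auto simp: det_mul)
  have eA: "ennreal \<bar>det A\<bar> * emeasure lborel ((*v) A -` S) = emeasure lborel S"
    if "S \<in> sets borel" for S
  proof -
    have "emeasure (density (distr lborel borel ((*v) A)) (\<lambda>_. ennreal \<bar>det A\<bar>)) S = emeasure lborel S"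
      using assms(1) nz by (simp add: scales_lborel_def)
    then show ?thesis using that by (simp add: emeasure_density_const emeasure_distr)
  qed
  have eB: "ennreal \<bar>det B\<bar> * emeasure lborel ((*v) B -` S) = emeasure lborel S"
    if "S \<in> sets borel" for S
  proof -
    have "emeasure (density (distr lborel borel ((*v) B)) (\<lambda>_. ennreal \<bar>det B\<bar>)) S = emeasure lborel S"
      using assms(2) nz by (simp add: scales_lborel_def)
    then show ?thesis using that by (simp add: emeasure_density_const emeasure_distr)
  qed
  show "density (distr lborel borel ((*v) (A ** B))) (\<lambda>_. ennreal \<bar>det (A ** B)\<bar>) = lborel"
  proof (rule measure_eqI)
    fix S assume "S \<in> sets (density (distr lborel borel ((*v) (A ** B))) (\<lambda>_. ennreal \<bar>det (A ** B)\<bar>))"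
    then have S: "S \<in> sets borel" by simp
    have AS: "(*v) A -` S \<in> sets borel"
      using measurable_sets[OF measurable_matrix_vector_mult S] by simp
    have "(*v) (A ** B) -` S = (*v) B -` ((*v) A -` S)"
      by (auto simp: matrix_vector_mul_assoc)
    then have "ennreal \<bar>det (A ** B)\<bar> * emeasure lborel ((*v) (A ** B) -` S) =
        ennreal \<bar>det A\<bar> * (ennreal \<bar>det B\<bar> * emeasure lborel ((*v) B -` ((*v) A -` S)))"
      by (simp add: det_mul abs_mult ennreal_mult mult.assoc)
    also have "\<dots> = emeasure lborel S" using eA[OF S] eB[OF AS] by simp
    finally show "emeasure (density (distr lborel borel ((*v) (A ** B))) (\<lambda>_. ennreal \<bar>det (A ** B)\<bar>)) S
        = emeasure lborel S"
      using S by (simp add: emeasure_density_const emeasure_distr)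
  qed simp
qed

lemma scales_lborel_diagonal:
  fixes A :: "real^'n^'n"
  assumes "\<And>i j. i \<noteq> j \<Longrightarrow> A $ i $ j = 0"
  shows "scales_lborel A"
  unfolding scales_lborel_def
proof
  assume "det A \<noteq> 0"
  moreover have det: "det A = (\<Prod>i\<in>UNIV. A $ i $ i)" using assms by (rule det_diagonal)
  ultimately have nz: "A $ i $ i \<noteq> 0" for i by auto
  define c where "c j = (\<Sum>i\<in>UNIV. A $ i $ i * j $ i)" for j
  have c: "c (axis i 1) = A $ i $ i" for i
    by (simp add: c_def axis_def if_distrib cong: if_cong)
  have "A *v x = 0 + (\<Sum>j\<in>Basis. (c j * (x \<bullet> j)) *\<^sub>R j)" for x
  proof -
    have "(A *v x) $ i = A $ i $ i * x $ i" for i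
    proof -
      have "(\<Sum>j\<in>UNIV. A $ i $ j * x $ j) = (\<Sum>j\<in>UNIV. if j = i then A $ i $ i * x $ i else 0)"
        using assms by (intro sum.cong) auto
      then show ?thesis by (simp add: matrix_vector_mult_def)
    qed
    then show ?thesis
      by (simp add: vec_eq_iff sum_Basis_cart c inner_axis) (simp add: axis_def if_distrib cong: if_cong)
  qed
  then have T: "(*v) A = (\<lambda>x. 0 + (\<Sum>j\<in>Basis. (c j * (x \<bullet> j)) *\<^sub>R j))" by auto
  have "c j \<noteq> 0" if "j \<in> Basis" for j
    using that nz by (auto simp: Basis_vec_def c)
  from lborel_affine_euclidean[of c 0, OF this]
  have "lborel = density (distr lborel borel ((*v) A)) (\<lambda>_. \<Prod>j\<in>Basis. \<bar>c j\<bar>)"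
    by (simp add: T)
  also have "(\<Prod>j\<in>Basis. \<bar>c j\<bar>) = \<bar>det A\<bar>"
    by (simp add: prod_Basis_cart c det abs_prod)
  finally show "density (distr lborel borel ((*v) A)) (\<lambda>_. ennreal \<bar>det A\<bar>) = lborel" by simp
qed

text \<open>A transposition of coordinates is an involution, so its determinant squares to 1, and it maps boxes
to boxes of the same volume.\<close>

lemma scales_lborel_swap:
  fixes m n :: "'n::finite"
  shows "scales_lborel (\<chi> i j::'n. mat 1 $ i $ Transposition.transpose m n j)"
  unfolding scales_lborel_def
proof
  let ?t = "Transposition.transpose m n"
  let ?P = "\<chi> i j. mat 1 $ i $ ?t j :: real^'n^'n"
  have Px: "?P *v x = (\<chi> i. x $ ?t i)" for x
  proof -
    have "(\<Sum>j\<in>UNIV. (if i = ?t j then 1 else 0) * x $ j) = x $ ?t i" for i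
    proof -
      have "(\<Sum>j\<in>UNIV. (if i = ?t j then 1 else 0) * x $ j) = (\<Sum>j\<in>UNIV. if j = ?t i then x $ j else 0)"
        by (intro sum.cong) (auto simp: transpose_eq_iff)
      then show ?thesis by simp
    qed
    then show ?thesis by (simp add: vec_eq_iff matrix_vector_mult_def mat_def)
  qed
  have "(?P ** ?P) *v x = mat 1 *v x" for x
    by (simp add: matrix_vector_mul_assoc[symmetric] Px)
  then have "?P ** ?P = mat 1" by (metis matrix_eq)
  then have "det ?P * det ?P = 1" by (metis det_I det_mul)
  then have 1: "\<bar>det ?P\<bar> = 1" 
    using abs_square_eq_1[of "det ?P"] by (simp add: power2_eq_square)
  show "density (distr lborel borel ((*v) ?P)) (\<lambda>_. ennreal \<bar>det ?P\<bar>) = lborel"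
    unfolding 1
  proof (rule lborel_eqI[symmetric])
    fix l u :: "real^'n" assume lu: "\<And>b. b \<in> Basis \<Longrightarrow> l \<bullet> b \<le> u \<bullet> b"
    have lu': "l $ i \<le> u $ i" for i using lu[of "axis i 1"] by (simp add: inner_axis)
    have "(*v) ?P -` box l u = box (\<chi> i. l $ ?t i) (\<chi> i. u $ ?t i)"
    proof -
      have "(\<forall>i. l $ i < x $ ?t i \<and> x $ ?t i < u $ i) \<longleftrightarrow> (\<forall>i. l $ ?t i < x $ i \<and> x $ i < u $ ?t i)" for x
        by (metis transpose_involutory)
      then show ?thesis by (auto simp: Px mem_box_cart)
    qed
    moreover have "\<forall>b\<in>Basis. (\<chi> i. l $ ?t i) \<bullet> b \<le> (\<chi> i. u $ ?t i) \<bullet> b"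
      by (auto simp: Basis_vec_def inner_axis lu')
    ultimately have "emeasure lborel ((*v) ?P -` box l u) = (\<Prod>i\<in>UNIV. u $ ?t i - l $ ?t i)"
      by (simp add: emeasure_lborel_box_eq prod_Basis_cart inner_axis)
    also have "(\<Prod>i\<in>UNIV. u $ ?t i - l $ ?t i) = (\<Prod>i\<in>UNIV. u $ i - l $ i)"
      by (rule prod.reindex_bij_betw) simp
    finally show "emeasure (density (distr lborel borel ((*v) ?P)) (\<lambda>_. ennreal 1)) (box l u)
        = (\<Prod>b\<in>Basis. (u - l) \<bullet> b)"
      by (simp add: emeasure_density_const emeasure_distr prod_Basis_cart inner_axis)
  qed simp
qed

text \<open>A shear preserves the volume of intervals. Linearity extends this to all measurable sets of finite
measure, in particular to the preimage of a box.\<close>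

lemma scales_lborel_shear:
  fixes m n :: "'n::finite"
  assumes "m \<noteq> n"
  shows "scales_lborel (\<chi> i j::'n. of_bool (i = m \<and> j = n \<or> i = j))"
  unfolding scales_lborel_def
proof
  let ?P = "\<chi> i j. of_bool (i = m \<and> j = n \<or> i = j) :: real^'n^'n"
  have Px: "?P *v x = (\<chi> i. if i = m then x $ m + x $ n else x $ i)" for x
  proof -
    have "(\<Sum>j\<in>UNIV. of_bool (i = m \<and> j = n \<or> i = j) * x $ j) = (if i = m then x $ m + x $ n else x $ i)" for i
    proof -
      have "(\<Sum>j\<in>UNIV. of_bool (i = m \<and> j = n \<or> i = j) * x $ j)
          = (\<Sum>j\<in>UNIV. (if j = i then x $ j else 0) + (if j = n then (if i = m then x $ j else 0) else 0))"
        using assms by (intro sum.cong) auto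
      then show ?thesis by (simp add: sum.distrib)
    qed
    then show ?thesis by (simp add: vec_eq_iff matrix_vector_mult_def)
  qed
  have "?P = (\<chi> k. if k = m then row m (mat 1) + 1 *s row n (mat 1) else row k (mat 1))"
    using assms by (auto simp: vec_eq_iff row_def mat_def)
  then have 1: "det ?P = 1" using det_row_operation[OF assms, of "mat 1" 1] by simp
  have lin: "linear ((*v) ?P)" by simp
  have inj: "inj ((*v) ?P)" 
    using det_nz_iff_inj[OF lin] 1 by simp
  have surj: "surj ((*v) ?P)" using linear_injective_imp_surjective[OF lin inj] by simp
  have shear: "measure lebesgue ((*v) ?P ` cbox a b) = 1 * measure lebesgue (cbox a b)" for a b
  proof (cases "cbox a b = {}")
    case False
    \<comment> \<open>\<open>measure_shear_interval\<close> needs a lower corner with nonnegative \<open>n\<close>-th entry, so the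
      lower corner is moved to the origin.\<close>
    have "(*v) ?P ` cbox a b = (+) (?P *v a) ` ((*v) ?P ` cbox 0 (b - a))"
    proof -
      have "cbox a b = (+) a ` cbox 0 (b - a)" by (simp add: cbox_translation[symmetric])
      then show ?thesis by (simp add: image_image matrix_vector_right_distrib)
    qed
    then have "measure lebesgue ((*v) ?P ` cbox a b) = measure lebesgue ((*v) ?P ` cbox 0 (b - a))"
      by (simp add: measure_translation)
    also have "\<dots> = measure lebesgue (cbox 0 (b - a))"
    proof -
      have "cbox 0 (b - a) \<noteq> {}" using False by (simp add: box_ne_empty inner_diff_left)
      from measure_shear_interval[OF assms this] show ?thesis unfolding Px by simp
    qed
    also have "\<dots> = measure lebesgue ((+) a ` cbox 0 (b - a))" by (simp add: measure_translation)
    also have "(+) a ` cbox 0 (b - a) = cbox a b" by (simp add: cbox_translation[symmetric])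
    finally show ?thesis by simp
  qed simp
  show "density (distr lborel borel ((*v) ?P)) (\<lambda>_. ennreal \<bar>det ?P\<bar>) = lborel"
    unfolding 1
  proof (rule lborel_eqI[symmetric])
    fix l u :: "real^'n" assume lu: "\<And>b. b \<in> Basis \<Longrightarrow> l \<bullet> b \<le> u \<bullet> b"
    let ?S = "(*v) ?P -` box l u"
    have img: "(*v) ?P ` ?S = box l u" using surj by (simp add: surj_image_vimage_eq)
    have S: "?S \<in> sets borel" using measurable_sets[OF measurable_matrix_vector_mult[of ?P], of "box l u"] by simp
    have "bounded ?S"
    proof -
      obtain g where g: "linear g" "g \<circ> (*v) ?P = id"
        using linear_injective_left_inverse[OF lin inj] by blast
      have gP: "g (?P *v x) = x" for x using fun_cong[OF g(2), of x] by simp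
      have "?S \<subseteq> g ` box l u"
      proof
        fix x assume "x \<in> ?S"
        then show "x \<in> g ` box l u" by (intro image_eqI[of _ _ "?P *v x"]) (simp_all only: gP vimage_eq)
      qed
      moreover have "bounded (g ` box l u)"
        using g(1) bounded_linear_image linear_linear bounded_box by metis
      ultimately show ?thesis by (rule bounded_subset[rotated])
    qed
    then have lm: "?S \<in> lmeasurable" using S
      by (simp add: bounded_set_imp_lmeasurable)
    have "measure lebesgue ?S = measure lebesgue (box l u)"
      using measure_linear_sufficient[OF lin lm shear] unfolding img by simp
    also have "measure lebesgue (box l u) = (\<Prod>b\<in>Basis. (u - l) \<bullet> b)"
      using lu by (simp add: measure_lborel_box_eq)
    finally have "measure lebesgue ?S = (\<Prod>b\<in>Basis. (u - l) \<bullet> b)" .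
    moreover have "emeasure lborel ?S = ennreal (measure lebesgue ?S)"
    proof -
      have "emeasure lebesgue ?S = ennreal (measure lebesgue ?S)"
        using lm by (rule emeasure_eq_measure2)
      moreover have "emeasure lebesgue ?S = emeasure lborel ?S"
        using S by (simp add: emeasure_completion main_part_sets)
      ultimately show ?thesis by simp
    qed
    ultimately show "emeasure (density (distr lborel borel ((*v) ?P)) (\<lambda>_. ennreal \<bar>1\<bar>)) (box l u)
        = (\<Prod>b\<in>Basis. (u - l) \<bullet> b)"
      by (simp add: emeasure_density_const emeasure_distr)
  qed simp
qed

lemma lborel_linear_image:
  fixes A :: "real^'n^'n"
  assumes "det A \<noteq> 0"
  shows "lborel = density (distr lborel borel ((*v) A)) (\<lambda>_. ennreal \<bar>det A\<bar>)"
proof -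
  have "scales_lborel A"
  proof (rule induct_matrix_elementary_alt)
    show "scales_lborel A" if "row i A = 0" for A :: "real^'n^'n" and i
      using that by (simp add: scales_lborel_def det_zero_row)
  qed (rule scales_lborel_mult scales_lborel_diagonal scales_lborel_swap scales_lborel_shear; assumption)+
  then show ?thesis using assms by (simp add: scales_lborel_def)
qed

abbreviation std_normal :: "real measure" where
  "std_normal \<equiv> density lborel (\<lambda>x. ennreal (std_normal_density x))"

interpretation std_normal: prob_space std_normal
  by (rule prob_space_normal_density) simp

lemma matrix_inv_mat_1 [simp]: "matrix_inv (mat 1 :: real^'n^'n) = mat 1"
  by (rule matrix_inv_unique_right) simp

section \<open>Gaussian measures\<close>

lemma gaussian_mat_1:
  "gaussian (mat 1 :: real^'n^'n) = density lborel (\<lambda>x. ennreal (\<Prod>i\<in>UNIV. std_normal_density (x $ i)))"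
proof -
  have "exp (- (x \<bullet> (matrix_inv (mat 1 :: real^'n^'n) *v x)) / 2) / sqrt ((2 * pi) ^ CARD('n) * det (mat 1 :: real^'n^'n))
      = (\<Prod>i\<in>UNIV. std_normal_density (x $ i))" for x :: "real^'n"
  proof -
    have "(\<Prod>i\<in>UNIV. std_normal_density (x $ i))
        = (1 / sqrt (2 * pi)) ^ CARD('n) * exp (\<Sum>i\<in>UNIV. - (x $ i)\<^sup>2 / 2)"
      by (simp add: std_normal_density_def prod.distrib exp_sum prod_dividef power_one_over)
    also have "(\<Sum>i\<in>UNIV. - (x $ i)\<^sup>2 / 2) = - (x \<bullet> x) / 2"
      by (simp add: inner_vec_def power2_eq_square sum_negf sum_divide_distrib)
    also have "(1 / sqrt (2 * pi)) ^ CARD('n) = 1 / sqrt ((2 * pi) ^ CARD('n))"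
      by (metis power_one_over real_sqrt_power)
    finally show ?thesis by simp
  qed
  then show ?thesis unfolding gaussian_def by simp
qed

lemma sets_gaussian [simp, measurable_cong]: "sets (gaussian A) = sets borel"
  by (simp add: gaussian_def)

lemma space_gaussian [simp]: "space (gaussian A) = UNIV"
  by (simp add: gaussian_def)

text \<open>The components of a standard Gaussian vector are independent and standard normal: both measures
agree on products of measurable sets because the density and Lebesgue measure factorise. Moments and
marginals of the standard Gaussian are read off from the product measure.\<close>

lemma gaussian_mat_1_components:
  "distr (gaussian (mat 1 :: real^'n^'n)) (\<Pi>\<^sub>M i\<in>UNIV. std_normal) (\<lambda>x i. x $ i) = (\<Pi>\<^sub>M i\<in>UNIV. std_normal)"
proof -
  interpret product_sigma_finite "\<lambda>i::'n. std_normal" by standard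
  have [measurable]: "(\<lambda>x i. x $ i) \<in> (borel :: (real^'n) measure) \<rightarrow>\<^sub>M (\<Pi>\<^sub>M i\<in>UNIV. std_normal)"
    by (rule measurable_PiM_single') (auto intro!: borel_measurable_continuous_onI continuous_intros)
  show ?thesis
  proof (rule PiM_eqI)
    fix A :: "'n \<Rightarrow> real set" assume A: "\<And>i. i \<in> UNIV \<Longrightarrow> A i \<in> sets std_normal"
    then have [measurable]: "\<And>i. A i \<in> sets borel" by simp
    \<comment> \<open>\<open>nn_integral_lborel_prod\<close> indexes the factors by basis vectors; \<open>idx\<close> recovers the
      coordinate from the basis vector.\<close>
    define idx :: "real^'n \<Rightarrow> 'n" where "idx b = (SOME i. b = axis i 1)" for b
    have idx: "idx (axis i 1) = i" for i
      unfolding idx_def by (rule some_equality) (auto simp: axis_eq_axis)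
    define f where "f b t = ennreal (std_normal_density t) * indicator (A (idx b)) t" for b t
    have f_measurable [measurable]: "f b \<in> borel_measurable borel" for b
      unfolding f_def by measurable
    have "Pi\<^sub>E UNIV A \<in> sets (\<Pi>\<^sub>M i\<in>UNIV. std_normal)"
      using A by (intro sets_PiM_I_finite) auto
    then have "emeasure (distr (gaussian (mat 1 :: real^'n^'n)) (\<Pi>\<^sub>M i\<in>UNIV. std_normal) (\<lambda>x i. x $ i)) (Pi\<^sub>E UNIV A)
        = emeasure (gaussian (mat 1 :: real^'n^'n)) ((\<lambda>x i. x $ i) -` Pi\<^sub>E UNIV A)"
      by (subst emeasure_distr) auto
    also have "\<dots> = (\<integral>\<^sup>+x. ennreal (\<Prod>i\<in>UNIV. std_normal_density (x $ i)) *
        indicator ((\<lambda>x i. x $ i) -` Pi\<^sub>E UNIV A) x \<partial>lborel)"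
      unfolding gaussian_mat_1
    proof (rule emeasure_density)
      show "(\<lambda>x i. x $ i) -` Pi\<^sub>E UNIV A \<in> sets (lborel :: (real^'n) measure)"
        using measurable_sets[of "\<lambda>x i. x $ i" borel "\<Pi>\<^sub>M i\<in>UNIV. std_normal" "Pi\<^sub>E UNIV A"]
          \<open>Pi\<^sub>E UNIV A \<in> _\<close> by simp
    qed measurable
    also have "\<dots> = (\<integral>\<^sup>+x. (\<Prod>b\<in>Basis. f b (x \<bullet> b)) \<partial>lborel)"
    proof (rule nn_integral_cong)
      fix x :: "real^'n"
      have "indicator ((\<lambda>x i. x $ i) -` Pi\<^sub>E UNIV A) x = (\<Prod>i\<in>UNIV. indicator (A i) (x $ i) :: ennreal)"
      proof (cases "\<forall>i. x $ i \<in> A i")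
        case True then show ?thesis by (simp add: PiE_iff)
      next
        case False
        then obtain i where "x $ i \<notin> A i" by blast
        then have "(\<Prod>i\<in>UNIV. indicator (A i) (x $ i) :: ennreal) = 0"
          by (intro prod_zero bexI[of _ i]) auto
        then show ?thesis using False by (auto simp: PiE_iff)
      qed
      then show "ennreal (\<Prod>i\<in>UNIV. std_normal_density (x $ i)) * indicator ((\<lambda>x i. x $ i) -` Pi\<^sub>E UNIV A) x
          = (\<Prod>b\<in>Basis. f b (x \<bullet> b))"
        by (simp add: f_def prod_Basis_cart idx inner_axis prod.distrib prod_ennreal[symmetric])
    qed
    also have "\<dots> = (\<Prod>b\<in>Basis. \<integral>\<^sup>+t. f b t \<partial>lborel)"
      by (rule nn_integral_lborel_prod) auto
    also have "\<dots> = (\<Prod>i\<in>UNIV. emeasure std_normal (A i))"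
      by (simp add: prod_Basis_cart f_def idx emeasure_density)
    finally show "emeasure (distr (gaussian (mat 1 :: real^'n^'n)) (\<Pi>\<^sub>M i\<in>UNIV. std_normal) (\<lambda>x i. x $ i)) (Pi\<^sub>E UNIV A)
        = (\<Prod>i\<in>UNIV. emeasure std_normal (A i))" .
  qed auto
qed

lemma measurable_vec_lambda_PiM [measurable]:
  assumes "\<And>i. sets (M i) = sets borel"
  shows "(\<lambda>f. \<chi> i. f i) \<in> (\<Pi>\<^sub>M i\<in>UNIV. M i) \<rightarrow>\<^sub>M (borel :: (real^'n) measure)"
proof -
  have comp: "(\<lambda>f. f i) \<in> (\<Pi>\<^sub>M i\<in>UNIV. M i) \<rightarrow>\<^sub>M borel" for i
    using measurable_component_singleton[of i UNIV M] measurable_cong_sets[OF refl assms] by blast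
  have eq: "(\<lambda>f. \<chi> i. f i) = (\<lambda>f. \<Sum>i\<in>UNIV. f i *\<^sub>R axis i (1::real))"
    by (auto simp: fun_eq_iff vec_eq_iff axis_def if_distrib cong: if_cong)
  show ?thesis unfolding eq using comp by measurable
qed

lemma gaussian_mat_1_eq_distr_PiM:
  "gaussian (mat 1 :: real^'n^'n) = distr (\<Pi>\<^sub>M i\<in>UNIV. std_normal) borel (\<lambda>f. \<chi> i. f i)"
proof -
  have [measurable]: "(\<lambda>x i. x $ i) \<in> (borel :: (real^'n) measure) \<rightarrow>\<^sub>M (\<Pi>\<^sub>M i\<in>UNIV. std_normal)"
    by (rule measurable_PiM_single') (auto intro!: borel_measurable_continuous_onI continuous_intros)
  have "distr (\<Pi>\<^sub>M i\<in>UNIV. std_normal) borel (\<lambda>f. \<chi> i. f i)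
      = distr (gaussian (mat 1 :: real^'n^'n)) borel (\<lambda>x. x)"
    by (subst gaussian_mat_1_components[symmetric], subst distr_distr)
      (auto simp: o_def intro!: measurable_vec_lambda_PiM)
  also have "\<dots> = gaussian (mat 1)"
    by (rule distr_id2) simp
  finally show ?thesis by simp
qed

lemma prob_space_gaussian_mat_1: "prob_space (gaussian (mat 1 :: real^'n^'n))"
proof -
  interpret P: prob_space "\<Pi>\<^sub>M i\<in>(UNIV::'n set). std_normal"
    by (rule prob_space_PiM) (rule std_normal.prob_space_axioms)
  show ?thesis unfolding gaussian_mat_1_eq_distr_PiM
    by (rule P.prob_space_distr) (auto intro!: measurable_vec_lambda_PiM)
qed

lemma gaussian_mat_1_reindex:
  fixes s :: "'m::finite \<Rightarrow> 'n::finite"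
  assumes "inj s"
  shows "distr (gaussian (mat 1 :: real^'n^'n)) borel (\<lambda>z. \<chi> i. z $ s i) = gaussian (mat 1 :: real^'m^'m)"
proof -
  have meas: "(\<lambda>\<omega>. \<lambda>n\<in>UNIV. \<omega> (s n)) \<in> (\<Pi>\<^sub>M i\<in>(UNIV::'n set). std_normal) \<rightarrow>\<^sub>M (\<Pi>\<^sub>M i\<in>(UNIV::'m set). std_normal)"
    by (intro measurable_restrict measurable_component_singleton) auto
  then have meas': "(\<lambda>\<omega> n. \<omega> (s n)) \<in> (\<Pi>\<^sub>M i\<in>(UNIV::'n set). std_normal) \<rightarrow>\<^sub>M (\<Pi>\<^sub>M i\<in>(UNIV::'m set). std_normal)"
    by (simp add: restrict_def)
  have meas2: "(\<lambda>z. \<chi> i. z $ s i) \<in> borel_measurable (borel :: (real^'n) measure)"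
    by (intro borel_measurable_continuous_onI continuous_intros)
  have "distr (gaussian (mat 1 :: real^'n^'n)) borel (\<lambda>z. \<chi> i. z $ s i)
      = distr (\<Pi>\<^sub>M i\<in>UNIV. std_normal) borel (\<lambda>f. \<chi> i. f (s i))"
    unfolding gaussian_mat_1_eq_distr_PiM
    by (subst distr_distr) (auto simp: o_def intro!: measurable_vec_lambda_PiM meas2)
  also have "\<dots> = distr (distr (\<Pi>\<^sub>M i\<in>UNIV. std_normal) (\<Pi>\<^sub>M i\<in>UNIV. std_normal) (\<lambda>\<omega>. \<lambda>n\<in>UNIV. \<omega> (s n))) borel (\<lambda>f. \<chi> i. f i)"
    by (subst distr_distr) (auto simp: o_def restrict_def intro!: measurable_vec_lambda_PiM meas')
  also have "distr (\<Pi>\<^sub>M i\<in>UNIV. std_normal) (\<Pi>\<^sub>M i\<in>UNIV. std_normal) (\<lambda>\<omega>. \<lambda>n\<in>UNIV. \<omega> (s n))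
      = (\<Pi>\<^sub>M i\<in>UNIV. std_normal)"
    using assms by (intro distr_PiM_reindex) (auto intro: std_normal.prob_space_axioms)
  finally show ?thesis by (simp add: gaussian_mat_1_eq_distr_PiM)
qed

text \<open>The monomial is written as a product over all coordinates with exponents \<open>m k\<close>, so that its
integral factorises into moments of the standard normal distribution.\<close>

lemma gaussian_mat_1_moment:
  fixes i j :: "'n::finite"
  shows "has_bochner_integral (gaussian (mat 1 :: real^'n^'n)) (\<lambda>x. x $ i * x $ j) (of_bool (i = j))"
proof -
  interpret product_sigma_finite "\<lambda>i::'n. std_normal" by standard
  define m :: "'n \<Rightarrow> nat" where "m k = of_bool (k = i) + of_bool (k = j)" for k
  have mon: "(\<Prod>k\<in>UNIV. f k ^ m k) = f i * f j" for f :: "'n \<Rightarrow> real"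
  proof -
    have "(\<Prod>k\<in>UNIV. f k ^ of_bool (k = i')) = f i'" for i'
    proof -
      have "(\<Prod>k\<in>UNIV. f k ^ of_bool (k = i')) = (\<Prod>k\<in>UNIV. if k = i' then f k else 1)"
        by (intro prod.cong) auto
      then show ?thesis by simp
    qed
    then show ?thesis by (simp add: m_def power_add prod.distrib)
  qed
  have int: "integrable std_normal (\<lambda>t. t ^ k)" for k
    by (subst integrable_real_density) (auto intro: integrable_std_normal_moment)
  have mom: "(\<integral>t. t ^ k \<partial>std_normal) = (\<integral>t. std_normal_density t * t ^ k \<partial>lborel)" for k
    by (subst integral_real_density) auto
  have mom0: "(\<integral>t. 1 \<partial>std_normal) = (1::real)" using std_normal.prob_space by simp
  have mom1: "(\<integral>t. t \<partial>std_normal) = 0" using mom[of 1] integral_std_normal_moment_odd[of 0] by simp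
  have mom2: "(\<integral>t. t ^ 2 \<partial>std_normal) = 1" using mom[of 2] integral_std_normal_moment_even[of 1] by simp
  have "integrable (\<Pi>\<^sub>M k\<in>UNIV. std_normal) (\<lambda>x. \<Prod>k\<in>UNIV. x k ^ m k)"
    by (rule product_integrable_prod) (auto intro: int)
  moreover have "(\<integral>x. (\<Prod>k\<in>UNIV. x k ^ m k) \<partial>(\<Pi>\<^sub>M k\<in>UNIV. std_normal)) = (\<Prod>k\<in>UNIV. \<integral>t. t ^ m k \<partial>std_normal)"
    by (rule product_integral_prod) (auto intro: int)
  moreover have "(\<Prod>k\<in>UNIV. \<integral>t. t ^ m k \<partial>std_normal) = of_bool (i = j)"
  proof (cases "i = j")
    case True
    then have "(\<integral>t. t ^ m k \<partial>std_normal) = 1" for k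
      using mom0 mom2 by (cases "k = i") (simp_all add: m_def numeral_2_eq_2)
    then show ?thesis using True by simp
  next
    case False
    then have "(\<integral>t. t ^ m i \<partial>std_normal) = 0" using mom1 by (simp add: m_def)
    then have "(\<Prod>k\<in>UNIV. \<integral>t. t ^ m k \<partial>std_normal) = 0" by (intro prod_zero) auto
    then show ?thesis using False by simp
  qed
  ultimately have "has_bochner_integral (\<Pi>\<^sub>M k\<in>UNIV. std_normal) (\<lambda>x. x i * x j) (of_bool (i = j))"
    by (simp add: has_bochner_integral_iff mon)
  then show ?thesis unfolding gaussian_mat_1_eq_distr_PiM
    by (simp add: has_bochner_integral_iff integrable_distr_eq integral_distr measurable_vec_lambda_PiM)
qed

text \<open>The quadratic form of the inverse of \<open>M ** transpose M\<close> becomes the squared norm after substituting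
\<open>M *v x\<close>, and the Jacobian \<open>\<bar>det M\<bar>\<close> cancels against the normalising constant. Together with
the factorisation of positive definite matrices, this reduces normalisation, moments and
marginals to the standard Gaussian.\<close>

lemma gaussian_linear_image:
  fixes M :: "real^'n^'n"
  assumes "det M \<noteq> 0"
  shows "gaussian (M ** transpose M) = distr (gaussian (mat 1)) borel ((*v) M)"
proof -
  let ?g = "\<lambda>x. exp (- (x \<bullet> (matrix_inv (M ** transpose M) *v x)) / 2) / sqrt ((2 * pi) ^ CARD('n) * det (M ** transpose M))"
  let ?h = "\<lambda>x. exp (- (x \<bullet> (matrix_inv (mat 1 :: real^'n^'n) *v x)) / 2) / sqrt ((2 * pi) ^ CARD('n) * det (mat 1 :: real^'n^'n))"
  have "gaussian (M ** transpose M) = density (density (distr lborel borel ((*v) M)) (\<lambda>_. ennreal \<bar>det M\<bar>)) (\<lambda>x. ennreal (?g x))"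
    unfolding gaussian_def using lborel_linear_image[OF assms] by simp
  also have "\<dots> = density (distr lborel borel ((*v) M)) (\<lambda>x. ennreal \<bar>det M\<bar> * ennreal (?g x))"
    by (rule density_density_eq) auto
  also have "\<dots> = distr (density lborel (\<lambda>x. ennreal \<bar>det M\<bar> * ennreal (?g (M *v x)))) borel ((*v) M)"
    by (rule density_distr) auto
  also have "(\<lambda>x. ennreal \<bar>det M\<bar> * ennreal (?g (M *v x))) = (\<lambda>x. ennreal (?h x))"
  proof
    fix x
    let ?N = "matrix_inv M"
    have N: "M ** ?N = mat 1" "?N ** M = mat 1" using matrix_inv_mult[OF assms] by auto
    have N': "transpose M ** transpose ?N = mat 1" by (metis N(2) matrix_transpose_mul transpose_mat)
    have "matrix_inv (M ** transpose M) = transpose ?N ** ?N"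
    proof (rule matrix_inv_unique_right)
      have "M ** transpose M ** (transpose ?N ** ?N) = M ** (transpose M ** transpose ?N) ** ?N"
        by (simp only: matrix_mul_assoc)
      then show "M ** transpose M ** (transpose ?N ** ?N) = mat 1" by (simp add: N N')
    qed
    then have "matrix_inv (M ** transpose M) *v (M *v x) = transpose ?N *v (?N *v (M *v x))"
      by (simp only: matrix_vector_mul_assoc matrix_mul_assoc)
    also have "?N *v (M *v x) = x" by (simp add: matrix_vector_mul_assoc N)
    finally have "(M *v x) \<bullet> (matrix_inv (M ** transpose M) *v (M *v x)) = (?N *v (M *v x)) \<bullet> x"
      by (metis dot_lmul_matrix inner_commute transpose_matrix_vector)
    then have q: "(M *v x) \<bullet> (matrix_inv (M ** transpose M) *v (M *v x)) = x \<bullet> x"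
      by (simp add: matrix_vector_mul_assoc N)
    have "sqrt ((2 * pi) ^ CARD('n) * det (M ** transpose M)) = sqrt ((2 * pi) ^ CARD('n)) * \<bar>det M\<bar>"
      by (simp add: det_mul real_sqrt_mult)
    then have "\<bar>det M\<bar> * ?g (M *v x) = ?h x" using assms q by simp
    then show "ennreal \<bar>det M\<bar> * ennreal (?g (M *v x)) = ennreal (?h x)"
      by (metis abs_ge_zero ennreal_mult' )
  qed
  finally show ?thesis by (simp add: gaussian_def)
qed

lemma gaussian_eq_linear_image:
  fixes X :: "real^'n^'n"
  assumes "pos_def X"
  obtains M :: "real^'n^'n" where "X = M ** transpose M" "gaussian X = distr (gaussian (mat 1)) borel ((*v) M)"
  using pos_def_factor[OF assms, of UNIV] gaussian_linear_image by metis

lemma prob_space_gaussian: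
  assumes "pos_def (X :: real^'n^'n)"
  shows "prob_space (gaussian X)"
proof -
  interpret prob_space "gaussian (mat 1 :: real^'n^'n)" by (rule prob_space_gaussian_mat_1)
  obtain M :: "real^'n^'n" where "gaussian X = distr (gaussian (mat 1)) borel ((*v) M)"
    using gaussian_eq_linear_image[OF assms] by metis
  then show ?thesis by (simp add: prob_space_distr)
qed

lemma gaussian_second_moment:
  assumes "pos_def (X :: real^'n^'n)"
  shows "has_bochner_integral (gaussian X) (\<lambda>z. z $ i * z $ j) (X $ i $ j)"
proof -
  obtain M :: "real^'n^'n" where M: "X = M ** transpose M" "gaussian X = distr (gaussian (mat 1)) borel ((*v) M)"
    using gaussian_eq_linear_image[OF assms] by metis
  have "has_bochner_integral (gaussian (mat 1)) (\<lambda>w. \<Sum>k\<in>UNIV. \<Sum>l\<in>UNIV. (M $ i $ k * M $ j $ l) * (w $ k * w $ l))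
      (\<Sum>k\<in>UNIV. \<Sum>l\<in>UNIV. (M $ i $ k * M $ j $ l) * of_bool (k = l))"
    by (intro has_bochner_integral_sum has_bochner_integral_mult_right gaussian_mat_1_moment)
  moreover have "(\<Sum>k\<in>UNIV. \<Sum>l\<in>UNIV. (M $ i $ k * M $ j $ l) * of_bool (k = l)) = X $ i $ j"
    by (simp add: M(1) matrix_matrix_mult_def transpose_def of_bool_def if_distrib cong: if_cong)
  moreover have "(\<lambda>w. \<Sum>k\<in>UNIV. \<Sum>l\<in>UNIV. (M $ i $ k * M $ j $ l) * (w $ k * w $ l)) = (\<lambda>w. (M *v w) $ i * (M *v w) $ j)"
    by (simp add: matrix_vector_mult_def sum_product ac_simps)
  ultimately show ?thesis unfolding M(2)
    by (simp add: has_bochner_integral_iff integrable_distr_eq integral_distr)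
qed

text \<open>The marginal on the coordinates selected by \<open>s\<close>. If a factor \<open>M\<close> has zero entries in the rows
from the range of \<open>s\<close> and the columns outside it, the selected coordinates of \<open>M *v w\<close> are the image of the selected
coordinates of \<open>w\<close> under the submatrix \<open>P\<close>, and the latter are again standard Gaussian.\<close>

lemma gaussian_marginal:
  fixes X :: "real^'n^'n" and s :: "'m::finite \<Rightarrow> 'n"
  assumes X: "pos_def X" and "inj s"
  shows "distr (gaussian X) borel (\<lambda>z. \<chi> i. z $ s i) = gaussian (\<chi> i j. X $ s i $ s j)"
proof -
  obtain M :: "real^'n^'n" where M: "X = M ** transpose M" "det M \<noteq> 0"
    "\<forall>i\<in>range s. \<forall>k. k \<notin> range s \<longrightarrow> M $ i $ k = 0"
    using pos_def_factor[OF X] by metis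
  define P where "P = (\<chi> i j. M $ s i $ s j)"
  have restrict: "(\<Sum>k\<in>UNIV. M $ s i $ k * f k) = (\<Sum>k\<in>UNIV. M $ s i $ s k * f (s k))" for i f
  proof -
    have "(\<Sum>k\<in>UNIV. M $ s i $ k * f k) = (\<Sum>k\<in>range s. M $ s i $ k * f k)"
      using M(3) by (intro sum.mono_neutral_right) auto
    also have "\<dots> = (\<Sum>k\<in>UNIV. M $ s i $ s k * f (s k))"
      using \<open>inj s\<close> by (simp add: sum.reindex)
    finally show ?thesis .
  qed
  have PP: "P ** transpose P = (\<chi> i j. X $ s i $ s j)"
    by (simp add: vec_eq_iff M(1) matrix_matrix_mult_def transpose_def P_def restrict)
  have "det P \<noteq> 0"
  proof -
    have "pos_def (\<chi> i j. X $ s i $ s j)"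
      unfolding pos_def_def
    proof (intro conjI allI impI)
      show "transpose (\<chi> i j. X $ s i $ s j) = (\<chi> i j. X $ s i $ s j)"
        using X unfolding pos_def_def transpose_def by (simp add: vec_eq_iff)
      fix x :: "real^'m" assume "x \<noteq> 0"
      \<comment> \<open>\<open>y\<close> is \<open>x\<close> extended by zero, so the form of the submatrix at \<open>x\<close> is the form of
        \<open>X\<close> at \<open>y\<close>.\<close>
      define y where "y = (\<chi> k. if k \<in> range s then x $ inv s k else 0)"
      have ys: "y $ s i = x $ i" for i using \<open>inj s\<close> by (simp add: y_def)
      have y0: "k \<notin> range s \<Longrightarrow> y $ k = 0" for k by (simp add: y_def)
      have "y \<noteq> 0" using \<open>x \<noteq> 0\<close> ys by (metis vec_eq_iff zero_index)
      have sy: "(\<Sum>k\<in>UNIV. f k * y $ k) = (\<Sum>k\<in>UNIV. f (s k) * x $ k)" for f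
      proof -
        have "(\<Sum>k\<in>UNIV. f k * y $ k) = (\<Sum>k\<in>range s. f k * y $ k)"
          using y0 by (intro sum.mono_neutral_right) auto
        also have "\<dots> = (\<Sum>k\<in>UNIV. f (s k) * x $ k)"
          using \<open>inj s\<close> by (simp add: sum.reindex ys)
        finally show ?thesis .
      qed
      have "y \<bullet> (X *v y) = (\<Sum>k\<in>UNIV. (\<Sum>l\<in>UNIV. X $ k $ l * y $ l) * y $ k)"
        by (simp add: inner_vec_def matrix_vector_mult_def mult.commute)
      also have "\<dots> = (\<Sum>k\<in>UNIV. (\<Sum>l\<in>UNIV. X $ s k $ s l * x $ l) * x $ k)"
        by (simp only: sy)
      also have "\<dots> = x \<bullet> ((\<chi> i j. X $ s i $ s j) *v x)"
        by (simp add: inner_vec_def matrix_vector_mult_def mult.commute)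
      finally show "0 < x \<bullet> ((\<chi> i j. X $ s i $ s j) *v x)"
        using X \<open>y \<noteq> 0\<close> unfolding pos_def_def by metis
    qed
    then have "det (P ** transpose P) \<noteq> 0" using pos_def_det_nz PP by metis
    then show ?thesis by (auto simp: det_mul)
  qed
  have meas [measurable]: "(\<lambda>z. \<chi> i. z $ s i) \<in> borel_measurable (borel :: (real^'n) measure)"
    by (intro borel_measurable_continuous_onI continuous_intros)
  have "distr (gaussian X) borel (\<lambda>z. \<chi> i. z $ s i)
      = distr (gaussian (mat 1)) borel (\<lambda>w. \<chi> i. (M *v w) $ s i)"
    unfolding M(1) gaussian_linear_image[OF M(2)] by (subst distr_distr) (auto simp: o_def)
  also have "(\<lambda>w. \<chi> i. (M *v w) $ s i) = (\<lambda>w. P *v (\<chi> i. w $ s i))"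
    by (simp add: fun_eq_iff vec_eq_iff matrix_vector_mult_def restrict P_def)
  also have "distr (gaussian (mat 1)) borel (\<lambda>w. P *v (\<chi> i. w $ s i))
      = distr (distr (gaussian (mat 1)) borel (\<lambda>w. \<chi> i. w $ s i)) borel ((*v) P)"
    by (subst distr_distr) (auto simp: o_def)
  also have "\<dots> = distr (gaussian (mat 1)) borel ((*v) P)"
    by (simp add: gaussian_mat_1_reindex[OF \<open>inj s\<close>])
  also have "\<dots> = gaussian (\<chi> i j. X $ s i $ s j)"
    using gaussian_linear_image[OF \<open>det P \<noteq> 0\<close>] PP by simp
  finally show ?thesis .
qed

section \<open>A variational bound for the Kullback-Leibler divergence\<close>

lemma ext_integral_integrable:
  assumes "integrable M f"
  shows "ext_integral M f = ereal (\<integral>x. f x \<partial>M)"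
proof -
  have fin: "(\<integral>\<^sup>+x. ennreal (f x) \<partial>M) < top" "(\<integral>\<^sup>+x. ennreal (- f x) \<partial>M) < top"
    using assms by (simp_all add: real_integrable_def less_top)
  have e: "enn2ereal x = ereal (enn2real x)" if "x < top" for x
    using that by (metis enn2ereal_ennreal enn2real_nonneg ennreal_enn2real)
  show ?thesis
    using fin by (simp add: ext_integral_def e real_lebesgue_integral_def[OF assms])
qed

text \<open>This is the Donsker-Varadhan inequality for test functions with \<open>\<integral> exp q dR \<le> 1\<close>. With
\<open>f = dP/dR\<close>, the elementary bound \<open>t \<le> exp t - 1\<close> at \<open>t = q - ln f\<close> gives
\<open>\<integral> (q - ln f) dP \<le> \<integral> exp q / f dP - 1 \<le> \<integral> exp q dR - 1 \<le> 0\<close>. The negative part of \<open>ln f\<close> is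
\<open>P\<close>-integrable because it is bounded by \<open>1 / f\<close>, whose \<open>P\<close>-integral is at most 1; so if \<open>ln f\<close> is not
integrable, the divergence is \<open>\<infinity>\<close>.\<close>

lemma KL_ge_integral:
  fixes P R :: "'a measure" and q :: "'a \<Rightarrow> real"
  assumes P: "prob_space P" and R: "prob_space R" and sets: "sets P = sets R"
    and q: "integrable P q" and exp_q: "(\<integral>\<^sup>+x. ennreal (exp (q x)) \<partial>R) \<le> 1"
  shows "ereal (\<integral>x. q x \<partial>P) \<le> KL P R"
proof (cases "absolutely_continuous R P")
  case False
  then show ?thesis by (simp add: KL_def)
next
  case ac: True
  interpret P: prob_space P by fact
  interpret R: prob_space R by fact
  define f where "f = RN_deriv R P"
  have f [measurable]: "f \<in> borel_measurable R" by (simp add: f_def)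
  have dens: "density R f = P" unfolding f_def using ac sets by (rule R.density_RN_deriv)
  define l where "l x = ln (enn2real (f x))" for x
  have ent: "entropy_density (exp 1) R P = l"
    by (simp add: entropy_density_def l_def f_def fun_eq_iff log_def)
  have [measurable]: "q \<in> borel_measurable R"
    using q sets measurable_cong_sets by blast
  have [measurable]: "l \<in> borel_measurable R" unfolding l_def by measurable
  have lP: "l \<in> borel_measurable P" using measurable_cong_sets[OF sets refl] \<open>l \<in> _\<close> by blast
  have nn_P: "(\<integral>\<^sup>+x. g x \<partial>P) = (\<integral>\<^sup>+x. f x * g x \<partial>R)" if "g \<in> borel_measurable R" for g
    using that by (simp add: nn_integral_density flip: dens)
  have "AE x in R. f x \<noteq> \<infinity>"
    unfolding f_def using P.sigma_finite_measure_axioms ac sets by (rule R.RN_deriv_finite)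
  then have f_pos: "AE x in P. 0 < enn2real (f x) \<and> ennreal (enn2real (f x)) = f x"
    unfolding dens[symmetric] by (subst AE_density) (auto simp: enn2real_positive_iff less_top)
  \<comment> \<open>An inequality, since the left-hand side is 0 where \<open>f\<close> is 0 or \<open>\<infinity>\<close>.\<close>
  have cancel: "f x * (g * inverse (f x)) \<le> g" for x g
  proof -
    have "a * inverse a \<le> 1" for a :: ennreal
      by (cases "a = 0 \<or> a = top") (auto simp: ennreal_divide_self less_top simp flip: divide_ennreal_def)
    then have "(f x * inverse (f x)) * g \<le> 1 * g" by (intro mult_right_mono) auto
    then show ?thesis by (simp add: ac_simps)
  qed
  have neg: "(\<integral>\<^sup>+x. ennreal (- l x) \<partial>P) \<le> 1"
  proof -
    have "(\<integral>\<^sup>+x. ennreal (- l x) \<partial>P) \<le> (\<integral>\<^sup>+x. 1 * inverse (f x) \<partial>P)"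
    proof (rule nn_integral_mono_AE, use f_pos in eventually_elim)
      case (elim x)
      then have "- l x \<le> inverse (enn2real (f x))"
        using ln_le_minus_one[of "inverse (enn2real (f x))"] by (simp add: l_def ln_inverse)
      then have "ennreal (- l x) \<le> ennreal (inverse (enn2real (f x)))" by (rule ennreal_leI)
      also have "\<dots> = inverse (f x)" using elim by (metis inverse_ennreal)
      finally show ?case by simp
    qed
    also have "\<dots> = (\<integral>\<^sup>+x. f x * (1 * inverse (f x)) \<partial>R)" by (rule nn_P) simp
    also have "\<dots> \<le> (\<integral>\<^sup>+x. 1 \<partial>R)" by (intro nn_integral_mono cancel)
    finally show ?thesis by (simp add: R.emeasure_space_1)
  qed
  then have neg_fin: "(\<integral>\<^sup>+x. ennreal (- l x) \<partial>P) < top"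
    using ennreal_one_less_top le_less_trans by blast
  show ?thesis
  proof (cases "(\<integral>\<^sup>+x. ennreal (l x) \<partial>P) = top")
    case True
    obtain r where "(\<integral>\<^sup>+x. ennreal (- l x) \<partial>P) = ennreal r" "0 \<le> r"
      using neg_fin by (metis ennreal_cases less_irrefl)
    then have "ext_integral P l = \<infinity>" using True by (simp add: ext_integral_def)
    then show ?thesis using ac by (simp add: KL_def ent)
  next
    case False
    then have l: "integrable P l" using neg_fin lP by (simp add: real_integrable_def)
    define h where "h x = exp (q x) / enn2real (f x)" for x
    have h_nn: "(\<integral>\<^sup>+x. ennreal (h x) \<partial>P) \<le> 1"
    proof -
      have "(\<integral>\<^sup>+x. ennreal (h x) \<partial>P) = (\<integral>\<^sup>+x. ennreal (exp (q x)) * inverse (f x) \<partial>P)"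
      proof (rule nn_integral_cong_AE, use f_pos in eventually_elim)
        case (elim x)
        then have "ennreal (h x) = ennreal (exp (q x)) * ennreal (inverse (enn2real (f x)))"
          by (simp add: h_def divide_inverse ennreal_mult)
        then show ?case using elim by (metis inverse_ennreal)
      qed
      also have "\<dots> = (\<integral>\<^sup>+x. f x * (ennreal (exp (q x)) * inverse (f x)) \<partial>R)" by (rule nn_P) simp
      also have "\<dots> \<le> (\<integral>\<^sup>+x. ennreal (exp (q x)) \<partial>R)" by (intro nn_integral_mono cancel)
      finally show ?thesis using exp_q by simp
    qed
    have hR: "h \<in> borel_measurable R" unfolding h_def by measurable
    have hP: "h \<in> borel_measurable P" using measurable_cong_sets[OF sets refl] hR by blast
    have h0: "0 \<le> h x" for x by (simp add: h_def)
    have h: "integrable P h"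
      using hP h0 h_nn by (intro integrableI_nonneg) (auto intro: le_less_trans)
    have "ennreal (\<integral>x. h x \<partial>P) \<le> ennreal 1"
      using h_nn nn_integral_eq_integral[OF h] h0 by simp
    then have h1: "(\<integral>x. h x \<partial>P) \<le> 1" by (simp add: ennreal_le_iff)
    have "(\<integral>x. q x - l x \<partial>P) \<le> (\<integral>x. h x - 1 \<partial>P)"
    proof (rule integral_mono_AE)
      show "AE x in P. q x - l x \<le> h x - 1"
      proof (use f_pos in eventually_elim)
        case (elim x)
        then have "h x = exp (q x - l x)" by (simp add: h_def l_def exp_diff)
        then show ?case using exp_ge_add_one_self[of "q x - l x"] by linarith
      qed
    qed (use q l h in auto)
    then have "(\<integral>x. q x \<partial>P) \<le> (\<integral>x. l x \<partial>P)"
      using q l h h1 by (simp add: P.prob_space)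
    then show ?thesis using ac by (simp add: KL_def ent ext_integral_integrable[OF l])
  qed
qed

lemma KL_density_exp:
  fixes q :: "'a \<Rightarrow> real"
  assumes "prob_space R" and [measurable]: "q \<in> borel_measurable R"
    and P: "P = density R (\<lambda>x. ennreal (exp (q x)))" and q: "integrable P q"
  shows "KL P R = ereal (\<integral>x. q x \<partial>P)"
proof -
  interpret R: prob_space R by fact
  have ac: "absolutely_continuous R P" unfolding P by (rule absolutely_continuousI_density) simp
  have "AE x in R. ennreal (exp (q x)) = RN_deriv R P x"
    by (rule R.RN_deriv_unique) (simp_all add: P)
  then have "AE x in R. entropy_density (exp 1) R P x = q x"
  proof eventually_elim
    case (elim x)
    show ?case by (simp add: entropy_density_def log_def elim[symmetric])
  qed
  then have "AE x in P. entropy_density (exp 1) R P x = q x"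
    using ac P by (intro absolutely_continuous_AE[of P R]) auto
  then have "ext_integral P (entropy_density (exp 1) R P) = ext_integral P q"
    unfolding ext_integral_def
    by (intro arg_cong2[where f = minus] arg_cong[where f = enn2ereal] nn_integral_cong_AE)
      (auto elim: eventually_mono)
  then show ?thesis using ac ext_integral_integrable[OF q] by (simp add: KL_def)
qed

section \<open>Gaussian couplings\<close>

definition join_vec :: "(real^'d) \<times> (real^'d) \<Rightarrow> real^('d::finite + 'd)" where
  "join_vec p = (\<chi> k. case k of Inl i \<Rightarrow> fst p $ i | Inr i \<Rightarrow> snd p $ i)"

lemma join_vec_split_vec [simp]: "join_vec (split_vec z) = z"
  by (simp add: join_vec_def split_vec_def vec_eq_iff split: sum.split)

lemma join_vec_nth [simp]:
  "join_vec p $ Inl i = fst p $ i" "join_vec p $ Inr i = snd p $ i"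
  by (simp_all add: join_vec_def)

lemma measurable_join_vec [measurable]:
  "(join_vec :: (real^'d) \<times> (real^'d) \<Rightarrow> real^('d::finite + 'd)) \<in> borel \<rightarrow>\<^sub>M borel"
proof -
  have "continuous_on UNIV (\<lambda>p :: (real^'d) \<times> (real^'d). case k of Inl i \<Rightarrow> fst p $ i | Inr i \<Rightarrow> snd p $ i)"
    for k :: "'d + 'd"
    by (cases k) (auto intro!: continuous_intros)
  then show ?thesis unfolding join_vec_def
    by (intro borel_measurable_continuous_onI continuous_on_vec_lambda) auto
qed

lemma measurable_join_vec_nth [measurable]: "(\<lambda>p. join_vec p $ k) \<in> borel_measurable borel"
  by (rule measurable_compose[OF measurable_join_vec])
    (intro borel_measurable_continuous_onI continuous_intros)

lemma measurable_split_vec [measurable]: "split_vec \<in> borel \<rightarrow>\<^sub>M borel"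
  unfolding split_vec_def by (intro borel_measurable_continuous_onI continuous_intros)

lemma sum_UNIV_Plus:
  "(\<Sum>k\<in>(UNIV :: ('a::finite + 'b::finite) set). f k) = (\<Sum>i\<in>UNIV. f (Inl i)) + (\<Sum>i\<in>UNIV. f (Inr i))"
  unfolding UNIV_Plus_UNIV[symmetric] by (subst sum.Plus) (simp_all add: o_def)

text \<open>The logarithm of the density of \<open>gaussian X\<close> with respect to \<open>gaussian S\<close>. It is a quadratic
polynomial, so its integral depends on second moments only.\<close>

definition log_ratio :: "real^'n^'n \<Rightarrow> real^'n^'n \<Rightarrow> real^'n \<Rightarrow> real" where
  "log_ratio X S z = (z \<bullet> (matrix_inv S *v z) - z \<bullet> (matrix_inv X *v z) + ln (det S) - ln (det X)) / 2"

lemma measurable_log_ratio [measurable]: "log_ratio X S \<in> borel_measurable borel"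
  unfolding log_ratio_def by measurable

lemma gaussian_density_gaussian:
  assumes "pos_def (X :: real^'n^'n)" "pos_def S"
  shows "gaussian X = density (gaussian S) (\<lambda>z. ennreal (exp (log_ratio X S z)))"
proof -
  have sqrt: "sqrt x = exp (ln x / 2)" if "0 < x" for x
    using exp_ln[of "sqrt x"] that by (simp add: ln_sqrt)
  have d: "0 < det X" "0 < det S" using assms by (simp_all add: pos_def_det_pos)
  let ?c = "sqrt ((2 * pi) ^ CARD('n))"
  have c: "?c > 0" by simp
  have "exp (- (z \<bullet> (matrix_inv S *v z)) / 2) / sqrt ((2 * pi) ^ CARD('n) * det S) * exp (log_ratio X S z)
      = exp (- (z \<bullet> (matrix_inv X *v z)) / 2) / sqrt ((2 * pi) ^ CARD('n) * det X)" for z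
  proof -
    have "exp (- (z \<bullet> (matrix_inv S *v z)) / 2) / sqrt ((2 * pi) ^ CARD('n) * det S) * exp (log_ratio X S z)
        = exp (- (z \<bullet> (matrix_inv S *v z)) / 2 - ln (det S) / 2 + log_ratio X S z) / ?c"
      using d by (simp add: real_sqrt_mult sqrt[of "det S"] exp_add exp_diff)
    also have "- (z \<bullet> (matrix_inv S *v z)) / 2 - ln (det S) / 2 + log_ratio X S z
        = - (z \<bullet> (matrix_inv X *v z)) / 2 - ln (det X) / 2"
      by (simp add: log_ratio_def field_simps)
    also have "exp (- (z \<bullet> (matrix_inv X *v z)) / 2 - ln (det X) / 2) / ?c
        = exp (- (z \<bullet> (matrix_inv X *v z)) / 2) / sqrt ((2 * pi) ^ CARD('n) * det X)"
      using d by (simp add: real_sqrt_mult sqrt[of "det X"] exp_diff)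
    finally show ?thesis .
  qed
  then show ?thesis unfolding gaussian_def
    by (subst density_density_eq) (auto simp flip: ennreal_mult'')
qed

lemma gaussian_pair_density:
  assumes "pos_def X" "pos_def S"
  shows "gaussian_pair X = density (gaussian_pair S) (\<lambda>p. ennreal (exp (log_ratio X S (join_vec p))))"
  unfolding gaussian_pair_def
  by (subst density_distr) (auto simp: gaussian_density_gaussian[OF assms] intro: measurable_split_vec)

lemma sets_gaussian_pair [simp, measurable_cong]: "sets (gaussian_pair X) = sets borel"
  by (simp add: gaussian_pair_def)

lemma space_gaussian_pair [simp]: "space (gaussian_pair X) = UNIV"
  by (simp add: gaussian_pair_def)

lemma prob_space_gaussian_pair:
  assumes "pos_def X" shows "prob_space (gaussian_pair X)"
proof -
  interpret prob_space "gaussian X" by (rule prob_space_gaussian[OF assms])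
  show ?thesis unfolding gaussian_pair_def by (rule prob_space_distr) (auto intro: measurable_split_vec)
qed

text \<open>Stated with \<open>has_bochner_integral\<close> rather than as an equation between integrals, so that the
existence of the moments is included.\<close>

definition second_moments :: "'a measure \<Rightarrow> ('a \<Rightarrow> real^'n) \<Rightarrow> real^'n^'n \<Rightarrow> bool" where
  "second_moments M f X \<longleftrightarrow> (\<forall>k l. has_bochner_integral M (\<lambda>p. f p $ k * f p $ l) (X $ k $ l))"

lemma hs_inner_sum: "hs_inner K X = (\<Sum>k\<in>UNIV. \<Sum>l\<in>UNIV. K $ k $ l * X $ k $ l)"
  by (simp add: hs_inner_def trace_def matrix_matrix_mult_def transpose_def)

lemma second_moments_quadratic_form:
  assumes "second_moments M f (X :: real^'n^'n)"
  shows "has_bochner_integral M (\<lambda>p. f p \<bullet> (K *v f p)) (hs_inner K X)"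
proof -
  have "has_bochner_integral M (\<lambda>p. \<Sum>k\<in>UNIV. \<Sum>l\<in>UNIV. K $ k $ l * (f p $ k * f p $ l)) (hs_inner K X)"
    unfolding hs_inner_sum using assms unfolding second_moments_def
    by (intro has_bochner_integral_sum has_bochner_integral_mult_right) auto
  then show ?thesis
    by (simp add: inner_vec_def matrix_vector_mult_def sum_distrib_left mult.left_commute)
qed

lemma second_moments_linear_form:
  assumes "second_moments M f (X :: real^'n^'n)"
  shows "has_bochner_integral M (\<lambda>p. (v \<bullet> f p)\<^sup>2) (v \<bullet> (X *v v))"
proof -
  let ?K = "\<chi> k l. v $ k * v $ l"
  have "x \<bullet> (?K *v x) = (v \<bullet> x)\<^sup>2" for x
    by (simp add: inner_vec_def matrix_vector_mult_def power2_eq_square sum_product sum_distrib_left ac_simps)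
  moreover have "hs_inner ?K X = v \<bullet> (X *v v)"
    by (simp add: hs_inner_sum inner_vec_def matrix_vector_mult_def sum_distrib_left ac_simps)
  ultimately show ?thesis using second_moments_quadratic_form[OF assms, of ?K] by simp
qed

lemma second_moments_psd:
  assumes "second_moments M f (X :: real^'n^'n)"
  shows "psd X"
  unfolding psd_def
proof (intro conjI allI)
  have "X $ k $ l = X $ l $ k" for k l
  proof -
    have "has_bochner_integral M (\<lambda>p. f p $ k * f p $ l) (X $ k $ l)"
      "has_bochner_integral M (\<lambda>p. f p $ k * f p $ l) (X $ l $ k)"
      using assms[unfolded second_moments_def, rule_format, of k l]
        assms[unfolded second_moments_def, rule_format, of l k] by (simp_all add: mult.commute)
    then show ?thesis by (rule has_bochner_integral_eq)
  qed
  then show "transpose X = X" by (simp add: transpose_def vec_eq_iff)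
  fix v
  have "v \<bullet> (X *v v) = (\<integral>p. (v \<bullet> f p)\<^sup>2 \<partial>M)"
    using second_moments_linear_form[OF assms] by (simp add: has_bochner_integral_iff)
  then show "0 \<le> v \<bullet> (X *v v)" by simp
qed

lemma second_moments_gaussian_pair:
  assumes "pos_def (X :: real^('d::finite + 'd)^('d + 'd))"
  shows "second_moments (gaussian_pair X) join_vec X"
  unfolding second_moments_def
proof (intro allI)
  fix k l :: "'d + 'd"
  have "(\<lambda>p. join_vec p $ k * join_vec p $ l) \<in> borel_measurable borel"
    by measurable
  then show "has_bochner_integral (gaussian_pair X) (\<lambda>p. join_vec p $ k * join_vec p $ l) (X $ k $ l)"
    using gaussian_second_moment[OF assms, of k l] measurable_split_vec
    by (simp add: gaussian_pair_def has_bochner_integral_iff integrable_distr_eq integral_distr)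
qed

lemma X_mat_nth [simp]:
  "X_mat A B C $ Inl i $ Inl j = A $ i $ j" "X_mat A B C $ Inl i $ Inr j = C $ i $ j"
  "X_mat A B C $ Inr i $ Inl j = C $ j $ i" "X_mat A B C $ Inr i $ Inr j = B $ i $ j"
  by (simp_all add: X_mat_def block_matrix_def transpose_def)

lemma sets_couplings:
  assumes "\<pi> \<in> couplings (gaussian A) (gaussian B)"
  shows "sets \<pi> = sets borel"
proof -
  have "sets \<pi> = sets (gaussian A \<Otimes>\<^sub>M gaussian B)" using assms by (simp add: couplings_def)
  also have "\<dots> = sets (borel \<Otimes>\<^sub>M borel)" by (intro sets_pair_measure_cong) simp_all
  finally show ?thesis by (simp only: borel_prod)
qed

text \<open>The diagonal blocks of the second moments are determined by the marginals. The mixed moments exist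
since \<open>\<bar>a b\<bar> \<le> a\<^sup>2 + b\<^sup>2\<close>, and they form the block \<open>C\<close>.\<close>

lemma coupling_second_moments:
  assumes A: "pos_def A" and B: "pos_def B" and \<pi>: "\<pi> \<in> couplings (gaussian A) (gaussian B)"
  obtains C where "second_moments \<pi> join_vec (X_mat A B C)"
proof -
  note sets = sets_couplings[OF \<pi>]
  have dA: "distr \<pi> (gaussian A) fst = gaussian A" and dB: "distr \<pi> (gaussian B) snd = gaussian B"
    using \<pi> by (simp_all add: couplings_def)
  have m: "f \<in> borel_measurable \<pi>" if "f \<in> borel_measurable borel" for f :: "_ \<Rightarrow> 'z::topological_space"
    using that measurable_cong_sets[OF sets refl] by blast
  have mfst: "fst \<in> \<pi> \<rightarrow>\<^sub>M gaussian A" and msnd: "snd \<in> \<pi> \<rightarrow>\<^sub>M gaussian B"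
    unfolding measurable_cong_sets[OF sets sets_gaussian]
    by (intro borel_measurable_continuous_onI continuous_intros)+
  have mA: "has_bochner_integral \<pi> (\<lambda>p. fst p $ i * fst p $ j) (A $ i $ j)" for i j
    using gaussian_second_moment[OF A, of i j] mfst
    by (subst (asm) dA[symmetric]) (simp add: has_bochner_integral_iff integrable_distr_eq integral_distr)
  have mB: "has_bochner_integral \<pi> (\<lambda>p. snd p $ i * snd p $ j) (B $ i $ j)" for i j
    using gaussian_second_moment[OF B, of i j] msnd
    by (subst (asm) dB[symmetric]) (simp add: has_bochner_integral_iff integrable_distr_eq integral_distr)
  define C where "C = (\<chi> i j. \<integral>p. fst p $ i * snd p $ j \<partial>\<pi>)"
  have mC: "has_bochner_integral \<pi> (\<lambda>p. fst p $ i * snd p $ j) (C $ i $ j)" for i j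
  proof -
    have "integrable \<pi> (\<lambda>p. fst p $ i * snd p $ j)"
    proof (rule Bochner_Integration.integrable_bound)
      show "integrable \<pi> (\<lambda>p. fst p $ i * fst p $ i + snd p $ j * snd p $ j)"
        using mA mB by (simp add: has_bochner_integral_iff)
      show "(\<lambda>p. fst p $ i * snd p $ j) \<in> borel_measurable \<pi>"
        by (rule m) (intro borel_measurable_continuous_onI continuous_intros)
      have "\<bar>a * b\<bar> \<le> a * a + b * b" for a b :: real
      proof -
        have "0 \<le> (\<bar>a\<bar> - \<bar>b\<bar>)\<^sup>2" by simp
        then have "2 * (\<bar>a\<bar> * \<bar>b\<bar>) \<le> a * a + b * b"
          by (simp add: power2_diff power2_eq_square algebra_simps)
        moreover have "0 \<le> \<bar>a\<bar> * \<bar>b\<bar>" by simp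
        ultimately show ?thesis unfolding abs_mult by linarith
      qed
      then show "AE p in \<pi>. norm (fst p $ i * snd p $ j) \<le> norm (fst p $ i * fst p $ i + snd p $ j * snd p $ j)"
        by (intro AE_I2) (simp add: order_trans[OF _ abs_ge_self])
    qed
    then show ?thesis by (simp add: has_bochner_integral_iff C_def)
  qed
  have "second_moments \<pi> join_vec (X_mat A B C)"
    unfolding second_moments_def
  proof (intro allI)
    fix k l :: "'a + 'a"
    show "has_bochner_integral \<pi> (\<lambda>p. join_vec p $ k * join_vec p $ l) (X_mat A B C $ k $ l)"
      using mA mB mC by (cases k; cases l) (simp_all add: mult.commute)
  qed
  then show thesis by (rule that)
qed

lemma gaussian_pair_in_couplings:
  assumes X: "pos_def (X_mat A B C)"
  shows "gaussian_pair (X_mat A B C) \<in> couplings (gaussian A) (gaussian B)"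
proof -
  let ?X = "X_mat A B C"
  have "(\<chi> i j. ?X $ Inl i $ Inl j) = A" "(\<chi> i j. ?X $ Inr i $ Inr j) = B"
    by (simp_all add: vec_eq_iff)
  then have marg: "distr (gaussian ?X) borel (\<lambda>z. \<chi> i. z $ Inl i) = gaussian A"
     "distr (gaussian ?X) borel (\<lambda>z. \<chi> i. z $ Inr i) = gaussian B"
    using gaussian_marginal[OF X, of Inl] gaussian_marginal[OF X, of Inr] by simp_all
  have "distr (gaussian_pair ?X) (gaussian A) fst = distr (gaussian_pair ?X) borel fst"
    by (rule distr_cong) simp_all
  also have "\<dots> = distr (gaussian ?X) borel (\<lambda>z. \<chi> i. z $ Inl i)"
    unfolding gaussian_pair_def
    by (subst distr_distr) (auto simp: o_def split_vec_def intro!: measurable_split_vec borel_measurable_continuous_onI continuous_intros)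
  finally have 1: "distr (gaussian_pair ?X) (gaussian A) fst = gaussian A" using marg by simp
  have "distr (gaussian_pair ?X) (gaussian B) snd = distr (gaussian_pair ?X) borel snd"
    by (rule distr_cong) simp_all
  also have "\<dots> = distr (gaussian ?X) borel (\<lambda>z. \<chi> i. z $ Inr i)"
    unfolding gaussian_pair_def
    by (subst distr_distr) (auto simp: o_def split_vec_def intro!: measurable_split_vec borel_measurable_continuous_onI continuous_intros)
  finally have 2: "distr (gaussian_pair ?X) (gaussian B) snd = gaussian B" using marg by simp
  have "sets (gaussian_pair ?X) = sets (borel \<Otimes>\<^sub>M borel)"
    by (simp only: borel_prod sets_gaussian_pair)
  also have "\<dots> = sets (gaussian A \<Otimes>\<^sub>M gaussian B)" by (intro sets_pair_measure_cong) simp_all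
  finally show ?thesis using 1 2 prob_space_gaussian_pair[OF X] by (simp add: couplings_def)
qed

section \<open>The objective of a coupling in terms of its second moments\<close>

text \<open>If \<open>X *v v = 0\<close> with \<open>v \<noteq> 0\<close>, then \<open>v \<bullet> z\<close> has second moment 0, so \<open>P\<close> is concentrated on a
hyperplane. This hyperplane is a null set for the reference Gaussian, hence \<open>P\<close> is not absolutely
continuous.\<close>

lemma KL_singular:
  assumes S: "pos_def S" and P: "prob_space P" "sets P = sets borel"
    and X: "second_moments P join_vec X" and "det X = 0"
  shows "KL P (gaussian_pair S) = \<infinity>"
proof -
  interpret P: prob_space P by fact
  obtain v where v: "v \<noteq> 0" "X *v v = 0"
  proof -
    have "\<not> inj ((*v) X)"
      using \<open>det X = 0\<close> det_nz_iff_inj[OF matrix_vector_mul_linear, of X] by simp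
    then obtain x y where "x \<noteq> y" "X *v x = X *v y" by (auto simp: inj_def)
    then show thesis using that[of "x - y"] by (simp add: matrix_vector_mult_diff_distrib)
  qed
  have mv: "(\<lambda>p. v \<bullet> join_vec p) \<in> borel_measurable borel" by measurable
  have int: "has_bochner_integral P (\<lambda>p. (v \<bullet> join_vec p)\<^sup>2) 0"
    using second_moments_linear_form[OF X, of v] v by simp
  then have "AE p in P. (v \<bullet> join_vec p)\<^sup>2 = 0"
    by (subst integral_nonneg_eq_0_iff_AE[symmetric]) (auto simp: has_bochner_integral_iff)
  then have P0: "AE p in P. v \<bullet> join_vec p = 0" by simp
  have "\<not> absolutely_continuous (gaussian_pair S) P"
  proof
    assume ac: "absolutely_continuous (gaussian_pair S) P"
    have "negligible {z. v \<bullet> z = 0}" using v(1) by (intro negligible_hyperplane) simp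
    moreover have "{z. v \<bullet> z = 0} \<in> sets lborel" by (simp add: closed_hyperplane)
    ultimately have "{z. v \<bullet> z = 0} \<in> null_sets lborel"
      by (metis negligible_iff_null_sets null_sets_completion_iff)
    then have "AE z in lborel. v \<bullet> z \<noteq> 0" using AE_not_in by fastforce
    then have "AE z in gaussian S. v \<bullet> z \<noteq> 0"
      unfolding gaussian_def by (subst AE_density) auto
    then have "AE p in gaussian_pair S. v \<bullet> join_vec p \<noteq> 0"
      unfolding gaussian_pair_def using mv
      by (subst AE_distr_iff) (auto intro: measurable_split_vec)
    then have "AE p in P. v \<bullet> join_vec p \<noteq> 0"
      using ac P(2) by (intro absolutely_continuous_AE[of P "gaussian_pair S"]) auto
    then have "AE p in P. False" using P0 by eventually_elim simp
    then show False by simp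
  qed
  then show ?thesis by (simp add: KL_def)
qed

text \<open>The term with \<open>matrix_inv X\<close> integrates to the trace of the identity, which is the dimension
\<open>2 d\<close>; this is the origin of the constant \<open>- 2 \<epsilon> d\<close> in the reduction.\<close>

lemma log_ratio_integral:
  fixes X :: "real^('d::finite + 'd)^('d + 'd)"
  assumes X: "pos_def X" and "prob_space P" and mom: "second_moments P join_vec X"
  shows "has_bochner_integral P (\<lambda>p. log_ratio X S (join_vec p))
    ((hs_inner (matrix_inv S) X - 2 * real CARD('d) + ln (det S) - ln (det X)) / 2)"
proof -
  interpret prob_space P by fact
  have "hs_inner (matrix_inv X) X = trace (mat 1 :: real^('d + 'd)^('d + 'd))"
    using X matrix_inv_mult[OF pos_def_det_nz[OF X]] by (simp add: hs_inner_def pos_def_def)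
  then have tr: "hs_inner (matrix_inv X) X = 2 * real CARD('d)"
    by (simp add: trace_I)
  have const: "has_bochner_integral P (\<lambda>_. c) c" for c :: real
    by (simp add: has_bochner_integral_iff prob_space)
  show ?thesis unfolding log_ratio_def tr[symmetric]
    by (intro has_bochner_integral_divide has_bochner_integral_add has_bochner_integral_diff
        second_moments_quadratic_form[OF mom] const)
qed

lemma Y_mat_quadratic_form:
  "join_vec p \<bullet> (Y_mat *v join_vec p) = (norm (fst p - snd p))\<^sup>2"
proof -
  have "join_vec p \<bullet> (Y_mat *v join_vec p)
      = (\<Sum>i\<in>UNIV. fst p $ i * (fst p $ i - snd p $ i)) + (\<Sum>i\<in>UNIV. snd p $ i * (snd p $ i - fst p $ i))"
    by (simp add: inner_vec_def matrix_vector_mult_def sum_UNIV_Plus Y_mat_def block_matrix_def mat_def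
        if_distrib[of "\<lambda>x. x * _"] if_distrib[of uminus] sum_negf cong: if_cong)
  also have "\<dots> = (norm (fst p - snd p))\<^sup>2"
    by (simp add: power2_norm_eq_inner inner_vec_def sum.distrib[symmetric] algebra_simps)
  finally show ?thesis .
qed

lemma hs_inner_add_scaleR: "hs_inner (P + c *\<^sub>R Q) X = hs_inner P X + c * hs_inner Q X"
  by (simp add: hs_inner_sum sum.distrib algebra_simps sum_distrib_left)

lemma matrix_objective_nonsingular:
  assumes "det (X_mat A B C) \<noteq> 0"
  shows "matrix_objective S \<epsilon> A B C = ereal
    (hs_inner (Y_mat + \<epsilon> *\<^sub>R matrix_inv S) (X_mat A B C) - \<epsilon> * ln (det (X_mat A B C)))"
  using assms by (simp add: matrix_objective_def neg_log_det_def)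

definition transport_objective ::
  "real^('d::finite + 'd)^('d + 'd) \<Rightarrow> real \<Rightarrow> ((real^'d) \<times> (real^'d)) measure \<Rightarrow> ereal" where
  "transport_objective S \<epsilon> \<pi> = enn2ereal (\<integral>\<^sup>+z. ennreal ((norm (fst z - snd z))\<^sup>2) \<partial>\<pi>) +
     ereal (2 * \<epsilon>) * KL \<pi> (gaussian_pair S)"

lemma transport_cost_eq:
  assumes "second_moments \<pi> join_vec X"
  shows "enn2ereal (\<integral>\<^sup>+z. ennreal ((norm (fst z - snd z))\<^sup>2) \<partial>\<pi>) = ereal (hs_inner Y_mat X)"
proof -
  have int: "has_bochner_integral \<pi> (\<lambda>p. (norm (fst p - snd p))\<^sup>2) (hs_inner Y_mat X)"
    using second_moments_quadratic_form[OF assms, of Y_mat] by (simp add: Y_mat_quadratic_form)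
  then have "(\<integral>\<^sup>+p. ennreal ((norm (fst p - snd p))\<^sup>2) \<partial>\<pi>) = ennreal (hs_inner Y_mat X)"
    by (subst nn_integral_eq_integral) (auto simp: has_bochner_integral_iff)
  moreover have "0 \<le> hs_inner Y_mat X"
    unfolding has_bochner_integral_integral_eq[OF int, symmetric] by simp
  ultimately show ?thesis by (simp add: enn2ereal_ennreal)
qed

text \<open>Among all measures with second moments \<open>X\<close>, the Gaussian has the least divergence. For nonsingular
\<open>X\<close> the variational bound is applied to the log-density of \<open>gaussian_pair X\<close>, whose exponential
integrates to 1 and whose own integral is the same for every measure with these second moments.\<close>

lemma matrix_objective_le_transport_objective:
  fixes A B C :: "real^'d::finite^'d"
  assumes S: "pos_def S" and "\<epsilon> > 0" and P: "prob_space \<pi>" "sets \<pi> = sets borel"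
    and mom: "second_moments \<pi> join_vec (X_mat A B C)"
  shows "matrix_objective S \<epsilon> A B C + ereal (\<epsilon> * ln (det S) - 2 * \<epsilon> * real CARD('d))
    \<le> transport_objective S \<epsilon> \<pi>"
proof (cases "det (X_mat A B C) = 0")
  case True
  then show ?thesis
    using KL_singular[OF S P mom] \<open>\<epsilon> > 0\<close> by (simp add: transport_objective_def transport_cost_eq[OF mom])
next
  case False
  let ?X = "X_mat A B C"
  let ?r = "(hs_inner (matrix_inv S) ?X - 2 * real CARD('d) + ln (det S) - ln (det ?X)) / 2"
  have X: "pos_def ?X" using second_moments_psd[OF mom] False by (rule psd_det_nz_imp_pos_def)
  interpret X: prob_space "gaussian_pair ?X" by (rule prob_space_gaussian_pair[OF X])
  have "emeasure (gaussian_pair ?X) UNIV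
      = (\<integral>\<^sup>+p. ennreal (exp (log_ratio ?X S (join_vec p))) \<partial>gaussian_pair S)"
    by (subst gaussian_pair_density[OF X S]) (simp add: emeasure_density)
  then have "(\<integral>\<^sup>+p. ennreal (exp (log_ratio ?X S (join_vec p))) \<partial>gaussian_pair S) \<le> 1"
    using X.emeasure_space_1 by simp
  moreover have lr: "has_bochner_integral \<pi> (\<lambda>p. log_ratio ?X S (join_vec p)) ?r"
    by (rule log_ratio_integral[OF X P(1) mom])
  ultimately have "ereal (\<integral>p. log_ratio ?X S (join_vec p) \<partial>\<pi>) \<le> KL \<pi> (gaussian_pair S)"
    using P prob_space_gaussian_pair[OF S]
    by (intro KL_ge_integral) (auto simp: has_bochner_integral_iff)
  then have "ereal ?r \<le> KL \<pi> (gaussian_pair S)"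
    by (simp only: has_bochner_integral_integral_eq[OF lr])
  then have "ereal (2 * \<epsilon>) * ereal ?r \<le> ereal (2 * \<epsilon>) * KL \<pi> (gaussian_pair S)"
    using \<open>\<epsilon> > 0\<close> by (intro ereal_mult_left_mono) auto
  then have "ereal (hs_inner Y_mat ?X) + ereal (2 * \<epsilon>) * ereal ?r \<le> transport_objective S \<epsilon> \<pi>"
    unfolding transport_objective_def transport_cost_eq[OF mom] by (rule add_left_mono)
  moreover have "ereal (hs_inner Y_mat ?X) + ereal (2 * \<epsilon>) * ereal ?r
      = matrix_objective S \<epsilon> A B C + ereal (\<epsilon> * ln (det S) - 2 * \<epsilon> * real CARD('d))"
    by (simp add: matrix_objective_nonsingular[OF False] hs_inner_add_scaleR field_simps)
  ultimately show ?thesis by simp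
qed

lemma transport_objective_gaussian_pair:
  fixes A B C :: "real^'d::finite^'d"
  assumes S: "pos_def S" and X: "pos_def (X_mat A B C)"
  shows "transport_objective S \<epsilon> (gaussian_pair (X_mat A B C))
    = matrix_objective S \<epsilon> A B C + ereal (\<epsilon> * ln (det S) - 2 * \<epsilon> * real CARD('d))"
proof -
  let ?X = "X_mat A B C"
  let ?r = "(hs_inner (matrix_inv S) ?X - 2 * real CARD('d) + ln (det S) - ln (det ?X)) / 2"
  note mom = second_moments_gaussian_pair[OF X]
  have "has_bochner_integral (gaussian_pair ?X) (\<lambda>p. log_ratio ?X S (join_vec p)) ?r"
    by (rule log_ratio_integral[OF X prob_space_gaussian_pair[OF X] mom])
  moreover have "(\<lambda>p. log_ratio ?X S (join_vec p)) \<in> borel_measurable (gaussian_pair S)"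
    by measurable
  ultimately have "KL (gaussian_pair ?X) (gaussian_pair S) = ereal ?r"
    using KL_density_exp[OF prob_space_gaussian_pair[OF S] _ gaussian_pair_density[OF X S]]
    by (simp add: has_bochner_integral_iff)
  then show ?thesis
    by (simp add: transport_objective_def transport_cost_eq[OF mom] hs_inner_add_scaleR
        matrix_objective_nonsingular[OF pos_def_det_nz[OF X]] field_simps)
qed

section \<open>Existence of a minimiser\<close>

lemma X_mat_quadratic_form:
  "z \<bullet> (X_mat A B C *v z) =
    (\<Sum>i\<in>UNIV. \<Sum>j\<in>UNIV. A $ i $ j * z $ Inl i * z $ Inl j + 2 * C $ i $ j * z $ Inl i * z $ Inr j
      + B $ i $ j * z $ Inr i * z $ Inr j)"
proof -
  have "(\<Sum>i\<in>UNIV. \<Sum>j\<in>UNIV. C $ j $ i * z $ Inr i * z $ Inl j) = (\<Sum>i\<in>UNIV. \<Sum>j\<in>UNIV. C $ i $ j * z $ Inl i * z $ Inr j)"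
    by (subst sum.swap) (simp add: ac_simps)
  then show ?thesis
    by (simp add: inner_vec_def matrix_vector_mult_def sum_UNIV_Plus sum.distrib distrib_left
        sum_distrib_left sum_distrib_right ac_simps)
qed

lemma continuous_on_X_mat: "continuous_on UNIV (\<lambda>C. X_mat A B C $ k $ l)"
  by (cases k; cases l) (auto intro!: continuous_intros)

lemma continuous_on_det [continuous_intros]:
  fixes f :: "'a::topological_space \<Rightarrow> real^'n^'n"
  assumes "\<And>k l. continuous_on T (\<lambda>x. f x $ k $ l)"
  shows "continuous_on T (\<lambda>x. det (f x))"
  unfolding det_def by (intro continuous_intros assms)

lemma compact_Pi_plus: "compact (Pi_plus A B)"
proof -
  have "closed (Pi_plus A B)"
  proof -
    have "Pi_plus A B = (\<Inter>k. \<Inter>l. {C. X_mat A B C $ k $ l = X_mat A B C $ l $ k}) \<inter>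
        (\<Inter>z. {C. 0 \<le> z \<bullet> (X_mat A B C *v z)})"
      unfolding Pi_plus_def psd_def transpose_def by (auto simp: vec_eq_iff)
    moreover have "closed {C. X_mat A B C $ k $ l = X_mat A B C $ l $ k}" for k l
      by (intro closed_Collect_eq continuous_on_X_mat)
    moreover have "closed {C. 0 \<le> z \<bullet> (X_mat A B C *v z)}" for z
      unfolding inner_vec_def matrix_vector_mult_def
      by (intro closed_Collect_le) (auto intro!: continuous_intros continuous_on_X_mat)
    ultimately show ?thesis by (simp only:) (intro closed_Int closed_INT ballI; assumption)
  qed
  moreover have "bounded (Pi_plus A B)"
  proof -
    have entry: "\<bar>C $ i $ j\<bar> \<le> \<bar>A $ i $ i\<bar> + \<bar>B $ j $ j\<bar>" if C: "C \<in> Pi_plus A B" for C i j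
    proof -
      have q: "0 \<le> z \<bullet> (X_mat A B C *v z)" for z using C by (simp add: Pi_plus_def psd_def)
      \<comment> \<open>With \<open>t = 1\<close> and \<open>t = -1\<close> this bounds the entry from both sides.\<close>
      have val: "z \<bullet> (X_mat A B C *v z) = A $ i $ i + 2 * t * C $ i $ j + t\<^sup>2 * B $ j $ j"
        if "z = axis (Inl i) 1 + t *\<^sub>R axis (Inr j) 1" for z t
      proof -
        have "z $ Inl i' = (if i' = i then 1 else 0)" "z $ Inr j' = (if j' = j then t else 0)" for i' j'
          using that by (auto simp: axis_def)
        then show ?thesis
          by (simp add: X_mat_quadratic_form sum.distrib if_distrib[of "\<lambda>x. _ * x"] if_distrib[of "\<lambda>x. x * t"] power2_eq_square cong: if_cong)
      qed
      have "0 \<le> A $ i $ i + 2 * C $ i $ j + B $ j $ j"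
        using q[of "axis (Inl i) 1 + 1 *\<^sub>R axis (Inr j) 1"] val[OF refl, of 1] by simp
      moreover have "0 \<le> A $ i $ i - 2 * C $ i $ j + B $ j $ j"
        using q[of "axis (Inl i) 1 + (-1) *\<^sub>R axis (Inr j) 1"] val[OF refl, of "-1"] by simp
      ultimately show ?thesis by linarith
    qed
    show ?thesis unfolding bounded_iff
    proof (intro exI ballI)
      fix C assume C: "C \<in> Pi_plus A B"
      have "norm C \<le> (\<Sum>i\<in>UNIV. norm (C $ i))" 
        unfolding norm_vec_def[of C] by (rule L2_set_le_sum) simp
      also have "\<dots> \<le> (\<Sum>i\<in>UNIV. \<Sum>j\<in>UNIV. \<bar>C $ i $ j\<bar>)" by (intro sum_mono norm_le_l1_cart)
      also have "\<dots> \<le> (\<Sum>i\<in>UNIV. \<Sum>j\<in>UNIV. \<bar>A $ i $ i\<bar> + \<bar>B $ j $ j\<bar>)" by (intro sum_mono entry[OF C])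
      finally show "norm C \<le> (\<Sum>i\<in>UNIV. \<Sum>j\<in>UNIV. \<bar>A $ i $ i\<bar> + \<bar>B $ j $ j\<bar>)" .
    qed
  qed
  ultimately show ?thesis by (simp add: compact_eq_bounded_closed)
qed

lemma pos_def_X_mat_0:
  assumes "pos_def A" "pos_def B"
  shows "pos_def (X_mat A B 0)"
  unfolding pos_def_def
proof (intro conjI allI impI)
  have "X_mat A B 0 $ k $ l = X_mat A B 0 $ l $ k" for k l
    using assms by (cases k; cases l) (simp_all add: pos_def_def transpose_def vec_eq_iff)
  then show "transpose (X_mat A B 0) = X_mat A B 0" by (simp add: transpose_def vec_eq_iff)
  fix z :: "real^('a + 'a)" assume "z \<noteq> 0"
  define x y where "x = (\<chi> i. z $ Inl i)" and "y = (\<chi> i. z $ Inr i)"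
  have eq: "z \<bullet> (X_mat A B 0 *v z) = x \<bullet> (A *v x) + y \<bullet> (B *v y)"
    unfolding X_mat_quadratic_form
    by (simp add: x_def y_def inner_vec_def matrix_vector_mult_def sum.distrib sum_distrib_left ac_simps)
  have "x \<noteq> 0 \<or> y \<noteq> 0"
  proof (rule ccontr)
    assume "\<not> (x \<noteq> 0 \<or> y \<noteq> 0)"
    then have "z $ k = 0" for k by (cases k) (auto simp: x_def y_def vec_eq_iff)
    then show False using \<open>z \<noteq> 0\<close> by (simp add: vec_eq_iff)
  qed
  moreover have "0 \<le> x \<bullet> (A *v x)" "0 \<le> y \<bullet> (B *v y)"
    using assms unfolding pos_def_def by (metis inner_zero_left order_le_less)+
  moreover have "x \<noteq> 0 \<Longrightarrow> 0 < x \<bullet> (A *v x)" "y \<noteq> 0 \<Longrightarrow> 0 < y \<bullet> (B *v y)"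
    using assms unfolding pos_def_def by auto
  ultimately show "0 < z \<bullet> (X_mat A B 0 *v z)" unfolding eq by linarith
qed

text \<open>The objective takes the value \<open>\<infinity>\<close>, so compactness is applied to the continuous real function
\<open>exp (- objective / \<epsilon>) = det X * exp (- h / \<epsilon>)\<close> instead, which attains its maximum. The maximum is
positive because \<open>C = 0\<close> is admissible with a nonsingular matrix; hence the maximiser is nonsingular
and minimises the objective.\<close>

lemma matrix_objective_attains_min:
  fixes A B :: "real^'d::finite^'d"
  assumes A: "pos_def A" and B: "pos_def B" and "\<epsilon> > 0"
  obtains C where "C \<in> Pi_plus A B" "pos_def (X_mat A B C)"
    "\<And>D. D \<in> Pi_plus A B \<Longrightarrow> matrix_objective S \<epsilon> A B C \<le> matrix_objective S \<epsilon> A B D"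
proof -
  define h where "h C = hs_inner (Y_mat + \<epsilon> *\<^sub>R matrix_inv S) (X_mat A B C)" for C
  define g where "g C = det (X_mat A B C) * exp (- (h C / \<epsilon>))" for C
  have "continuous_on UNIV h" unfolding h_def hs_inner_sum
    by (intro continuous_intros continuous_on_X_mat)
  then have "continuous_on UNIV g" unfolding g_def using \<open>\<epsilon> > 0\<close>
    by (intro continuous_intros continuous_on_X_mat) auto
  moreover have 0: "0 \<in> Pi_plus A B"
    using pos_def_X_mat_0[OF A B] unfolding Pi_plus_def psd_def pos_def_def
    by (auto simp: order_le_less) (metis inner_zero_left)
  ultimately obtain C where C: "C \<in> Pi_plus A B" "\<And>D. D \<in> Pi_plus A B \<Longrightarrow> g D \<le> g C"
    using continuous_attains_sup[of "Pi_plus A B" g] compact_Pi_plus continuous_on_subset by blast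
  have "0 < g 0" using pos_def_det_pos[OF pos_def_X_mat_0[OF A B]] by (simp add: g_def)
  also have "g 0 \<le> g C" by (rule C(2)[OF 0])
  finally have dC: "0 < det (X_mat A B C)" by (simp add: g_def zero_less_mult_iff)
  show thesis
  proof
    show "C \<in> Pi_plus A B" by fact
    then show "pos_def (X_mat A B C)"
      using dC by (intro psd_det_nz_imp_pos_def) (auto simp: Pi_plus_def)
    fix D assume D: "D \<in> Pi_plus A B"
    show "matrix_objective S \<epsilon> A B C \<le> matrix_objective S \<epsilon> A B D"
    proof (cases "det (X_mat A B D) = 0")
      case True
      then show ?thesis using \<open>\<epsilon> > 0\<close> by (simp add: matrix_objective_def neg_log_det_def)
    next
      case False
      have "psd (X_mat A B D)" using D by (simp add: Pi_plus_def)
      then have dD: "0 < det (X_mat A B D)"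
        using False psd_det_nz_imp_pos_def pos_def_det_pos by blast
      have ln_g: "ln (g E) = ln (det (X_mat A B E)) - h E / \<epsilon>" if "0 < det (X_mat A B E)" for E
        using that by (simp add: g_def ln_mult)
      have "0 < g D" using dD by (simp add: g_def)
      then have "ln (g D) \<le> ln (g C)" using C(2)[OF D] by simp
      then have "h C / \<epsilon> - ln (det (X_mat A B C)) \<le> h D / \<epsilon> - ln (det (X_mat A B D))"
        by (simp add: ln_g dC dD)
      then have "\<epsilon> * (h C / \<epsilon> - ln (det (X_mat A B C))) \<le> \<epsilon> * (h D / \<epsilon> - ln (det (X_mat A B D)))"
        using \<open>\<epsilon> > 0\<close> by (intro mult_left_mono) auto
      then show ?thesis using \<open>\<epsilon> > 0\<close> dC False
        by (simp add: matrix_objective_nonsingular h_def[symmetric] right_diff_distrib)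
    qed
  qed
qed

section \<open>Reduction of the transport problem to matrices\<close>

lemma psd_full_rank_imp_pos_def:
  assumes "psd (A :: real^'n^'n)" "rank A = CARD('n)"
  shows "pos_def A"
  using assms by (intro psd_det_nz_imp_pos_def) (simp_all add: det_eq_0_rank)

theorem lemma2p3:
  fixes A B :: "real^'d::finite^'d"
    and \<Sigma> :: "real^('d + 'd)^('d + 'd)"
    and \<epsilon> :: real
  assumes "psd A" and "rank A = CARD('d)"
    and "psd B" and "rank B = CARD('d)"
    and "pos_def \<Sigma>"
    and "\<epsilon> > 0"
  shows "\<exists>C. is_arg_min (matrix_objective \<Sigma> \<epsilon> A B) (\<lambda>C. C \<in> Pi_plus A B) C \<and>
    W_reg \<Sigma> \<epsilon> (gaussian A) (gaussian B) =
      matrix_objective \<Sigma> \<epsilon> A B C + ereal (\<epsilon> * ln (det \<Sigma>) - 2 * \<epsilon> * real CARD('d))"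
proof -
  have A: "pos_def A" and B: "pos_def B"
    using assms by (simp_all add: psd_full_rank_imp_pos_def)
  let ?c = "ereal (\<epsilon> * ln (det \<Sigma>) - 2 * \<epsilon> * real CARD('d))"
  obtain C where C: "C \<in> Pi_plus A B" "pos_def (X_mat A B C)"
    "\<And>D. D \<in> Pi_plus A B \<Longrightarrow> matrix_objective \<Sigma> \<epsilon> A B C \<le> matrix_objective \<Sigma> \<epsilon> A B D"
    using matrix_objective_attains_min[OF A B \<open>\<epsilon> > 0\<close>, of \<Sigma>] by metis
  have W: "W_reg \<Sigma> \<epsilon> (gaussian A) (gaussian B)
      = (INF \<pi> \<in> couplings (gaussian A) (gaussian B). transport_objective \<Sigma> \<epsilon> \<pi>)"
    by (simp add: W_reg_def transport_objective_def)
  have "W_reg \<Sigma> \<epsilon> (gaussian A) (gaussian B) = matrix_objective \<Sigma> \<epsilon> A B C + ?c"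
    unfolding W
  proof (rule antisym)
    show "(INF \<pi> \<in> couplings (gaussian A) (gaussian B). transport_objective \<Sigma> \<epsilon> \<pi>)
        \<le> matrix_objective \<Sigma> \<epsilon> A B C + ?c"
      using INF_lower[OF gaussian_pair_in_couplings[OF C(2)], of "transport_objective \<Sigma> \<epsilon>"]
      by (simp add: transport_objective_gaussian_pair[OF \<open>pos_def \<Sigma>\<close> C(2)])
    show "matrix_objective \<Sigma> \<epsilon> A B C + ?c
        \<le> (INF \<pi> \<in> couplings (gaussian A) (gaussian B). transport_objective \<Sigma> \<epsilon> \<pi>)"
    proof (rule INF_greatest)
      fix \<pi> assume \<pi>: "\<pi> \<in> couplings (gaussian A) (gaussian B)"
      obtain D where D: "second_moments \<pi> join_vec (X_mat A B D)"
        using coupling_second_moments[OF A B \<pi>] .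
      then have "D \<in> Pi_plus A B" using second_moments_psd by (auto simp: Pi_plus_def)
      then have "matrix_objective \<Sigma> \<epsilon> A B C + ?c \<le> matrix_objective \<Sigma> \<epsilon> A B D + ?c"
        by (intro add_right_mono C(3))
      also have "\<dots> \<le> transport_objective \<Sigma> \<epsilon> \<pi>"
        using matrix_objective_le_transport_objective[OF \<open>pos_def \<Sigma>\<close> \<open>\<epsilon> > 0\<close> _ _ D] \<pi> sets_couplings[OF \<pi>]
        by (simp add: couplings_def)
      finally show "matrix_objective \<Sigma> \<epsilon> A B C + ?c \<le> transport_objective \<Sigma> \<epsilon> \<pi>" .
    qed
  qed
  moreover have "is_arg_min (matrix_objective \<Sigma> \<epsilon> A B) (\<lambda>C. C \<in> Pi_plus A B) C"
    unfolding is_arg_min_def using C by (auto simp: not_less)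
  ultimately show ?thesis by blast
qed

end
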